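(* The system $(\widetilde\Sigma)$ $$\widetilde E\dot w(t)=\widetilde A_0w(t)+\widetilde A_1w(t-h)+\widetilde Bu(t),\qquad \widetilde y(t)=\widetilde Cw(t)$$ is left invertible if and only if, for every $\widehat u(\cdot)\in U_{-1}(s)$, $$T(s,\exp(-sh))\,\widehat u(s)\equiv 0\ \Longrightarrow\ \widehat u(s)\equiv 0,$$ where $T(s,\exp(-sh))=\widetilde C\,(s\widetilde E-\widetilde A_0-\widetilde A_1\exp(-sh))^{-1}\widetilde B$ is the transfer function of $(\widetilde\Sigma)$.
   Context: Let $U,H,Y$ be real Hilbert spaces, $h>0$, $\alpha\ge 0$, and let $E,A_0,A_1:H\to H$, $B:U\to H$, $C:H\to Y$ be linear operators ($E$ need not be invertible, $A_0,A_1$ may be unbounded, $B,C$ are bounded); for complex $s$ they are extended to the complexified spaces. They define the implicit delay system $E\ddot z(t)+\alpha\dot z(t)+A_0z(t)+A_1z(t-h)=Bu(t)$, $y(t)=Cz(t)$, with $z(0)=0$, $\dot z(0)=0$ and $z(t)=0$ for $t\in[-h,0)$. Put, in block form on $H\times H$, $$\widetilde E=\begin{pmatrix} I&0\\ 0&E\end{pmatrix},\ \widetilde A_0=\begin{pmatrix}0&I\\ -A_0&-\alpha I\end{pmatrix},\ \widetilde A_1=\begin{pmatrix}0&0\\ -A_1&0\end{pmatrix},\ \widetilde B=\begin{pmatrix}0\\ B\end{pmatrix},\ \widetilde C=\begin{pmatrix}0&0\\ C&0\end{pmatrix},$$ and $w=(z,\dot z)^T$, so that $w(0)=0$ and $w(t)=0$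 on $[-h,0)$. The system $(\widetilde\Sigma)$ is left invertible if $\widetilde y(t)\equiv 0$ implies $u(t)\equiv 0$ (with zero initial data $w(0)=0$ and $w(t)=0$ for $t\in[-h,0)$). Signals are studied through their Laplace transforms (denoted by a hat), assumed to exist; the transformed system is $(s\widetilde E-\widetilde A_0-\widetilde A_1\exp(-sh))\widehat w(s)=\widetilde B\widehat u(s)$, $\widehat y(s)=\widetilde C\widehat w(s)$. $U_{-1}(s)$ denotes the set of all strictly proper ($U$-valued, after complexification) functions of $s$; input transforms $\widehat u$ are taken in $U_{-1}(s)$. Standing assumption: the system is solvable, i.e. $s\widetilde E-\widetilde A_0-\widetilde A_1\exp(-sh)$ is invertible (for $s$ in some right half-plane), so that the transfer function is defined.
   Formalization: Left invertibility counts as an output of u any signal whose Laplace transform is the output of the transformed system, not only outputs of time-domain solutions w, since for some solvable systems no nonzero input has a solution; functions of s are analytic on a right half-plane. *)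

theory Defs
  imports "HOL-Analysis.Analysis"
begin

section \<open>Complexification\<close>

text \<open>The complexification of a real Hilbert space is represented by pairs (real part, imaginary
  part). The product norm is the Hilbert norm of the complexification. Only the multiplication
  by complex scalars has to be added.\<close>

type_synonym 'a complexified = "'a \<times> 'a"

definition cscale :: "complex \<Rightarrow> 'a::real_vector complexified \<Rightarrow> 'a complexified" where
  "cscale c x = (Re c *\<^sub>R fst x - Im c *\<^sub>R snd x, Re c *\<^sub>R snd x + Im c *\<^sub>R fst x)"

definition cext :: "('a \<Rightarrow> 'b) \<Rightarrow> 'a complexified \<Rightarrow> 'b complexified" where
  "cext A x = (A (fst x), A (snd x))"

section \<open>Functions of s, and the Laplace transform\<close>

text \<open>A property holds eventually along this filter iff it holds on some half-plane
  \<open>{s. Re s > a}\<close>. Functions of \<open>s\<close> are identified when they agree on such a half-plane.\<close>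

definition right_half_planes :: "complex filter" where
  "right_half_planes = filtercomap Re at_top"

definition vector_holomorphic_on ::
    "(complex \<Rightarrow> 'a::real_normed_vector complexified) \<Rightarrow> complex set \<Rightarrow> bool" where
  "vector_holomorphic_on F S \<longleftrightarrow> (\<forall>s\<in>S. \<exists>d. (F has_derivative (\<lambda>x. cscale x d)) (at s within S))"

text \<open>The set \<open>U\<^sub>-\<^sub>1(s)\<close>: analytic on some right half-plane and tending to \<open>0\<close> as \<open>\<bar>s\<bar> \<rightarrow> \<infinity>\<close> in it.\<close>

definition strictly_proper :: "(complex \<Rightarrow> 'a::real_normed_vector complexified) set" where
  "strictly_proper = {F. \<exists>a. vector_holomorphic_on F {s. Re s > a} \<and>
      (F \<longlongrightarrow> 0) (inf at_infinity (principal {s. Re s > a}))}"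

text \<open>The integral is the gauge integral, so that no separability is needed; it covers all
  (absolutely or conditionally) convergent Laplace integrals.\<close>

definition has_laplace ::
    "(real \<Rightarrow> 'a::real_normed_vector) \<Rightarrow> (complex \<Rightarrow> 'a complexified) \<Rightarrow> bool" where
  "has_laplace f F \<longleftrightarrow> (\<forall>\<^sub>F s in right_half_planes.
      ((\<lambda>t. cscale (exp (- s * of_real t)) (f t, 0)) has_integral F s) {0..})"

text \<open>Signals live on \<open>[0,\<infinity>)\<close> and are identified when they agree almost everywhere.\<close>

definition null_signal :: "(real \<Rightarrow> 'a::real_normed_vector) \<Rightarrow> bool" where
  "null_signal f \<longleftrightarrow> negligible {t \<in> {0..}. f t \<noteq> 0}"

section \<open>The implicit delay system\<close>

text \<open>Possibly unbounded operators come with a domain; their values outside it are irrelevant.\<close>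

definition linear_operator_on :: "'a::real_vector set \<Rightarrow> ('a \<Rightarrow> 'b::real_vector) \<Rightarrow> bool" where
  "linear_operator_on D A \<longleftrightarrow> subspace D \<and>
     (\<forall>x\<in>D. \<forall>y\<in>D. A (x + y) = A x + A y) \<and> (\<forall>c. \<forall>x\<in>D. A (c *\<^sub>R x) = c *\<^sub>R A x)"

record ('u, 'h, 'y) delay_system =
  delay :: real
  damping :: real
  domE :: "'h set"
  opE :: "'h \<Rightarrow> 'h"
  domA0 :: "'h set"
  opA0 :: "'h \<Rightarrow> 'h"
  domA1 :: "'h set"
  opA1 :: "'h \<Rightarrow> 'h"
  opB :: "'u \<Rightarrow> 'h"
  opC :: "'h \<Rightarrow> 'y"

definition blockE :: "('u, 'h, 'y) delay_system \<Rightarrow> 'h \<times> 'h \<Rightarrow> 'h \<times> 'h" where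
  "blockE \<Sigma> w = (fst w, opE \<Sigma> (snd w))"

definition blockA0 :: "('u, 'h::real_vector, 'y) delay_system \<Rightarrow> 'h \<times> 'h \<Rightarrow> 'h \<times> 'h" where
  "blockA0 \<Sigma> w = (snd w, - opA0 \<Sigma> (fst w) - damping \<Sigma> *\<^sub>R snd w)"

definition blockA1 :: "('u, 'h::real_vector, 'y) delay_system \<Rightarrow> 'h \<times> 'h \<Rightarrow> 'h \<times> 'h" where
  "blockA1 \<Sigma> w = (0, - opA1 \<Sigma> (fst w))"

definition blockB :: "('u, 'h::real_vector, 'y) delay_system \<Rightarrow> 'u \<Rightarrow> 'h \<times> 'h" where
  "blockB \<Sigma> u = (0, opB \<Sigma> u)"

definition blockC :: "('u, 'h, 'y::real_vector) delay_system \<Rightarrow> 'h \<times> 'h \<Rightarrow> 'y \<times> 'y" where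
  "blockC \<Sigma> w = (0, opC \<Sigma> (fst w))"

definition state_dom :: "('u, 'h, 'y) delay_system \<Rightarrow> ('h \<times> 'h) set" where
  "state_dom \<Sigma> = (domA0 \<Sigma> \<inter> domA1 \<Sigma>) \<times> domE \<Sigma>"

text \<open>The operator \<open>s E - A\<^sub>0 - q A\<^sub>1\<close> (block operators, complexified) has the domain
  \<open>state_dom \<Sigma> \<times> state_dom \<Sigma>\<close>; it is used with \<open>q = exp (- s h)\<close>.\<close>

definition pencil :: "('u, 'h::real_vector, 'y) delay_system \<Rightarrow> complex \<Rightarrow> complex \<Rightarrow>
    ('h \<times> 'h) complexified \<Rightarrow> ('h \<times> 'h) complexified" where
  "pencil \<Sigma> s q x =
     cscale s (cext (blockE \<Sigma>) x) - cext (blockA0 \<Sigma>) x - cscale q (cext (blockA1 \<Sigma>) x)"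

definition invertible_operator ::
    "'a::real_normed_vector set \<Rightarrow> ('a \<Rightarrow> 'b::real_normed_vector) \<Rightarrow> bool" where
  "invertible_operator D P \<longleftrightarrow> bij_betw P D UNIV \<and> (\<exists>K. \<forall>y. norm (the_inv_into D P y) \<le> K * norm y)"

definition delay_factor :: "('u, 'h, 'y) delay_system \<Rightarrow> complex \<Rightarrow> complex" where
  "delay_factor \<Sigma> s = exp (- s * of_real (delay \<Sigma>))"

definition solvable :: "('u, 'h::real_normed_vector, 'y) delay_system \<Rightarrow> bool" where
  "solvable \<Sigma> \<longleftrightarrow> (\<forall>\<^sub>F s in right_half_planes.
     invertible_operator (state_dom \<Sigma> \<times> state_dom \<Sigma>) (pencil \<Sigma> s (delay_factor \<Sigma> s)))"

definition transfer_function :: "('u, 'h::real_vector, 'y::real_vector) delay_system \<Rightarrow>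
    complex \<Rightarrow> complex \<Rightarrow> 'u complexified \<Rightarrow> ('y \<times> 'y) complexified" where
  "transfer_function \<Sigma> s q x = cext (blockC \<Sigma>)
     (the_inv_into (state_dom \<Sigma> \<times> state_dom \<Sigma>) (pencil \<Sigma> s q) (cext (blockB \<Sigma>) x))"

section \<open>Trajectories with zero initial data, and left invertibility\<close>

text \<open>Solutions in the time domain whose signals have Laplace transforms. The requirement that
  \<open>E w\<close> has the derivative \<open>E w'\<close> is automatic when \<open>E\<close> is bounded, and so is the existence of
  the transform of \<open>E w\<close>.\<close>

definition time_solution :: "('u, 'h::real_normed_vector, 'y) delay_system \<Rightarrow>
    (real \<Rightarrow> 'u) \<Rightarrow> (real \<Rightarrow> 'h \<times> 'h) \<Rightarrow> bool" where
  "time_solution \<Sigma> u w \<longleftrightarrow>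
     w 0 = 0 \<and> (\<forall>t\<in>{- delay \<Sigma>..<0}. w t = 0) \<and> (\<forall>t\<ge>0. w t \<in> state_dom \<Sigma>) \<and>
     (\<exists>w'. \<forall>t\<ge>0. snd (w' t) \<in> domE \<Sigma> \<and>
        (w has_vector_derivative w' t) (at t within {0..}) \<and>
        ((\<lambda>\<tau>. blockE \<Sigma> (w \<tau>)) has_vector_derivative blockE \<Sigma> (w' t)) (at t within {0..}) \<and>
        blockE \<Sigma> (w' t) = blockA0 \<Sigma> (w t) + blockA1 \<Sigma> (w (t - delay \<Sigma>)) + blockB \<Sigma> (u t)) \<and>
     (\<exists>F. has_laplace w F) \<and> (\<exists>F. has_laplace (\<lambda>t. blockE \<Sigma> (w t)) F) \<and>
     (\<exists>F. has_laplace (\<lambda>t. blockA0 \<Sigma> (w t)) F) \<and> (\<exists>F. has_laplace (\<lambda>t. blockA1 \<Sigma> (w t)) F)"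

text \<open>Solutions of the transformed system. A generalized state signal is given by its transform
  \<open>W\<close> only, on which differentiation (with zero initial value) acts as multiplication by \<open>s\<close> and
  the delay as multiplication by \<open>exp (- s h)\<close>.\<close>

definition transformed_solution ::
    "('u, 'h::real_vector, 'y::real_vector) delay_system \<Rightarrow> (complex \<Rightarrow> 'u complexified) \<Rightarrow>
     (complex \<Rightarrow> ('h \<times> 'h) complexified) \<Rightarrow> (complex \<Rightarrow> ('y \<times> 'y) complexified) \<Rightarrow> bool" where
  "transformed_solution \<Sigma> U W Y \<longleftrightarrow> (\<forall>\<^sub>F s in right_half_planes.
     W s \<in> state_dom \<Sigma> \<times> state_dom \<Sigma> \<and>
     pencil \<Sigma> s (delay_factor \<Sigma> s) (W s) = cext (blockB \<Sigma>) (U s) \<and>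
     Y s = cext (blockC \<Sigma>) (W s))"

text \<open>Time-domain solutions alone would not do: if \<open>E\<close> is quasinilpotent, \<open>A\<^sub>0 = I\<close>, \<open>A\<^sub>1 = 0\<close>, \<open>\<alpha> = 0\<close>,
  the system is solvable, but the inverse of the pencil may grow so fast that no nonzero input
  admits a state signal which is a function of time with a Laplace transform. Input and output
  are functions of time in both cases.\<close>

definition is_output :: "('u::real_normed_vector, 'h::real_normed_vector, 'y::real_normed_vector)
    delay_system \<Rightarrow> (real \<Rightarrow> 'u) \<Rightarrow> (real \<Rightarrow> 'y \<times> 'y) \<Rightarrow> bool" where
  "is_output \<Sigma> u y \<longleftrightarrow>
     (\<exists>w. time_solution \<Sigma> u w \<and> (\<forall>t\<ge>0. y t = blockC \<Sigma> (w t))) \<or>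
     (\<exists>U W Y. has_laplace u U \<and> has_laplace y Y \<and> transformed_solution \<Sigma> U W Y)"

text \<open>Inputs are the (strongly) measurable signals with a strictly proper Laplace transform.\<close>

definition admissible_input :: "(real \<Rightarrow> 'u::real_normed_vector) \<Rightarrow> bool" where
  "admissible_input u \<longleftrightarrow> u measurable_on {0..} \<and> (\<exists>U\<in>strictly_proper. has_laplace u U)"

definition left_invertible :: "('u::real_normed_vector, 'h::real_normed_vector,
    'y::real_normed_vector) delay_system \<Rightarrow> bool" where
  "left_invertible \<Sigma> \<longleftrightarrow> (\<forall>u y. admissible_input u \<longrightarrow> is_output \<Sigma> u y \<longrightarrow>
     null_signal y \<longrightarrow> null_signal u)"

end

theory Submission
  imports Defs "HOL-Complex_Analysis.Complex_Analysis" "HOL-Probability.Sinc_Integral"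
begin

text \<open>For every solution of the system, in the time or in the frequency domain, the transform of
  the output is the transfer function applied to the transform of the input. In the time domain the
  operators need not be closed: the bounded inverse of the pencil is applied to the Laplace integral
  of \<open>s E w - A\<^sub>0 w - q A\<^sub>1 w\<close>, and this yields the transform of \<open>w\<close> itself. So if the transfer
  function is injective on strictly proper inputs, then a zero output forces \<open>u\<close> to have a zero
  transform, and \<open>u\<close> is null by the uniqueness theorem for the (conditionally convergent, vector
  valued) Laplace integral.

  Conversely, a strictly proper \<open>U\<close> annihilated by the transfer function need not be the transform
  of a function. But \<open>U(s) / (s - a)^4\<close> is also annihilated, and it decays fast enough to be the
  transform of a continuous function, given by the inversion integral along a vertical line. The
  transfer function commutes with complex conjugation, so the real part of that function is an
  admissible input with output zero. By left invertibility it vanishes, that is, \<open>U(s)\<close> plus the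
  conjugate of \<open>U\<close> at the conjugate of \<open>s\<close> is zero. The same for \<open>i U\<close> gives \<open>U = 0\<close>.\<close>

section \<open>Uniqueness of the Laplace transform\<close>

text \<open>The Laplace integrals converge only conditionally and the spaces may be nonseparable, so
  interchange of integrals is confined to scalar functions; results reach vectors by pairing with
  real vectors. For inversion the vector valued integral must exist beforehand, and absolute
  convergence provides that. Strict properness gives a bound for \<open>U\<close> on Re s >= a + 1
  but no rate of decay; this is why a fixed power of s - a is divided out. On the line Re s = a + 1
  the modulus of (s - a)^4 is (1 + w^2)^2. One factor makes the inversion integral converge
  absolutely; the other absorbs the |w| that appears when two inversion integrals are subtracted.
  The inverse transform is thus an exponential times a Lipschitz function, hence continuous and
  measurable as an admissible input must be. Taking a real part is forced: signals have values in
  the real space, while \<open>U\<close> has values in its complexification. The state belonging to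
  the constructed input is given by its transform alone, as no time-domain state need exist.\<close>

lemma has_integral_Ici_tendsto:
  fixes f :: "real \<Rightarrow> 'a::banach"
  assumes "(f has_integral I) {a..}"
  shows "((\<lambda>T. integral {a..T} f) \<longlongrightarrow> I) at_top"
proof (rule tendstoI)
  fix e :: real assume "e > 0"
  then obtain B where B: "B > 0" "\<And>c d. ball 0 B \<subseteq> cbox c d \<Longrightarrow>
      norm (integral (cbox c d) (\<lambda>x. if x \<in> {a..} then f x else 0) - I) < e"
    using assms unfolding has_integral_alt' by blast
  show "\<forall>\<^sub>F T in at_top. dist (integral {a..T} f) I < e"
  proof (rule eventually_at_top_linorderI)
    fix T assume T: "T \<ge> max B \<bar>a\<bar>"
    \<comment> \<open>The box has to contain \<open>ball 0 B\<close>; starting it left of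
      \<open>a\<close> makes it cut the half-line exactly in \<open>{a..T}\<close>.\<close>
    let ?b = "min a (-B)"
    have "ball 0 B \<subseteq> cbox ?b T"
      using T by (auto simp: dist_real_def)
    then have "norm (integral (cbox ?b T) (\<lambda>x. if x \<in> {a..} then f x else 0) - I) < e"
      by (rule B)
    moreover have "integral (cbox ?b T) (\<lambda>x. if x \<in> {a..} then f x else 0) = integral {a..T} f"
    proof -
      have "integral (cbox ?b T) (\<lambda>x. if x \<in> {a..} then f x else 0) =
          integral ({a..} \<inter> cbox ?b T) f"
        by (simp only: integral_restrict_Int)
      moreover have "{a..} \<inter> cbox ?b T = {a..T}" by auto
      ultimately show ?thesis by simp
    qed
    ultimately show "dist (integral {a..T} f) I < e"
      by (simp add: dist_norm)
  qed
qed

lemma has_integral_UNIV_tendsto: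
  fixes f :: "real \<Rightarrow> 'a::banach"
  assumes "(f has_integral I) UNIV"
  shows "((\<lambda>T. integral {-T..T} f) \<longlongrightarrow> I) at_top"
proof (rule tendstoI)
  fix e :: real assume "e > 0"
  then obtain B where B: "B > 0" "\<And>c d. ball 0 B \<subseteq> cbox c d \<Longrightarrow>
      norm (integral (cbox c d) f - I) < e"
    using assms unfolding has_integral_alt' by auto
  show "\<forall>\<^sub>F T in at_top. dist (integral {-T..T} f) I < e"
  proof (rule eventually_at_top_linorderI)
    fix T assume T: "T \<ge> B"
    have "ball 0 B \<subseteq> cbox (-T) T"
      using T by (auto simp: dist_real_def)
    then have "norm (integral (cbox (-T) T) f - I) < e"
      by (rule B)
    then show "dist (integral {-T..T} f) I < e"
      by (simp add: dist_norm)
  qed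
qed

lemma integrable_on_Ici_continuous_bound:
  fixes f :: "real \<Rightarrow> 'a::banach"
  assumes cont: "continuous_on {a..} f" and g: "g integrable_on {a..}"
    and le: "\<And>x. x \<ge> a \<Longrightarrow> norm (f x) \<le> g x"
  shows "f integrable_on {a..}"
proof (rule integrable_on_all_intervals_integrable_bound[OF _ _ g])
  show "(\<lambda>x. if x \<in> {a..} then f x else 0) integrable_on cbox c d" for c d
  proof -
    have "f integrable_on {max a c..d}"
      by (intro integrable_continuous_interval continuous_on_subset[OF cont]) auto
    moreover have "{a..} \<inter> cbox c d = {max a c..d}" by auto
    ultimately show ?thesis
      by (simp only: integrable_restrict_Int)
  qed
qed (use le in auto)

text \<open>Lebesgue differentiation for the gauge integral: off a null set a function is the limit
  of its averages over short intervals to the right, and all averages of the extension by zero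
  vanish.\<close>

lemma negligible_of_zero_integrals:
  fixes f :: "real \<Rightarrow> real"
  assumes "\<And>t. t \<ge> 0 \<Longrightarrow> (f has_integral 0) {0..t}"
  shows "negligible {t \<in> {0..}. f t \<noteq> 0}"
proof -
  define g where "g = (\<lambda>t. if t \<in> {0..} then f t else 0)"
  have g0: "(g has_integral 0) {a..b}" for a b
  proof (cases "b \<le> 0 \<or> b < a")
    case True
    have "negligible ({a..b} \<inter> {x. g x \<noteq> 0})"
      by (rule negligible_subset [of "{0}"]) (use True in \<open>auto simp: g_def split: if_splits\<close>)
    then show ?thesis
      by (rule has_integral_negligible) auto
  next
    case False
    let ?a = "max a 0"
    have "(f has_integral 0) {0..b}" "(f has_integral 0) {0..?a}"
      using assms[of b] assms[of ?a] False by auto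
    then have "(f has_integral 0) {?a..b}"
      using False by (smt (verit) has_integral_combine has_integral_integrable
          integrable_subinterval_real atLeastatMost_subset_iff integrable_integral has_integral_unique)
    then have "(f has_integral 0) ({0..} \<inter> {a..b})"
      by (rule back_subst[where P = "\<lambda>S. (f has_integral 0) S"]) auto
    then show ?thesis
      by (simp only: g_def has_integral_restrict_Int)
  qed
  then have "\<And>a b. g integrable_on cbox a b" by (auto simp: integrable_on_def)
  then obtain N where N: "negligible N" "\<And>x e. \<lbrakk>x \<notin> N; 0 < e\<rbrakk> \<Longrightarrow> \<exists>d>0. \<forall>h. 0 < h \<and> h < d \<longrightarrow>
      norm (integral (cbox x (x + h *\<^sub>R One)) g /\<^sub>R h ^ DIM(real) - g x) < e"
    by (rule integrable_ccontinuous_explicit) (rule that; assumption)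
  have "g x = 0" if x: "x \<notin> N" for x
  proof (rule ccontr)
    assume "g x \<noteq> 0"
    then obtain d where d: "d > 0" "\<forall>h. 0 < h \<and> h < d \<longrightarrow>
      norm (integral (cbox x (x + h *\<^sub>R One)) g /\<^sub>R h ^ DIM(real) - g x) < norm (g x)"
      using N(2)[OF x, of "norm (g x)"] by auto
    have "norm (integral (cbox x (x + (d/2) *\<^sub>R One)) g /\<^sub>R (d/2) ^ DIM(real) - g x) < norm (g x)"
      using d(2)[rule_format, of "d/2"] d(1) by simp
    moreover have "integral (cbox x (x + (d/2) *\<^sub>R One)) g = 0"
      using integral_unique[OF g0] by simp
    ultimately show False by simp
  qed
  then show ?thesis
    by (intro negligible_subset[OF N(1)]) (fastforce simp: g_def)
qed

text \<open>The boundary term minus the weighted integral has difference quotients governed by the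
  second mean value theorem, hence is differentiable although \<open>f\<close> is merely gauge integrable.\<close>

lemma integration_by_parts_gauge:
  fixes f g g' :: "real \<Rightarrow> real"
  assumes f: "f integrable_on {a..b}" and ab: "a \<le> b"
    and g: "\<And>x. x \<in> {a..b} \<Longrightarrow> (g has_real_derivative g' x) (at x within {a..b})"
    and mono: "\<And>x y. \<lbrakk>a \<le> x; x \<le> y; y \<le> b\<rbrakk> \<Longrightarrow> g x \<le> g y"
  shows "((\<lambda>x. g' x * integral {a..x} f) has_integral
      (g b * integral {a..b} f - integral {a..b} (\<lambda>x. g x * f x))) {a..b}"
proof -
  define P where "P = (\<lambda>t. integral {a..t} f)"
  define H where "H = (\<lambda>t. g t * P t - integral {a..t} (\<lambda>x. g x * f x))"
  have contP: "continuous_on {a..b} P"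
    unfolding P_def using f by (rule indefinite_integral_continuous_1)
  have gf: "(\<lambda>x. g x * f x) integrable_on {a..b}"
    by (rule second_mean_value_theorem_full[OF f ab, of g]) (use mono in auto)
  \<comment> \<open>With the mean value point \<open>c\<close> the terms in \<open>g x * P x\<close>
    and \<open>g y * P y\<close> cancel, so the increment of \<open>H\<close> is exactly an
    increment of \<open>g\<close> times a value of \<open>P\<close>.\<close>
  have incr: "\<exists>c\<in>{x..y}. H y - H x = (g y - g x) * P c" if "a \<le> x" "x \<le> y" "y \<le> b" for x y
  proof -
    have fxy: "f integrable_on {x..y}"
      using f that by (auto intro: integrable_subinterval_real)
    obtain c where c: "c \<in> {x..y}"
      "((\<lambda>t. g t * f t) has_integral (g x * integral {x..c} f + g y * integral {c..y} f)) {x..y}"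
      by (rule second_mean_value_theorem_full[OF fxy \<open>x \<le> y\<close>, of g]) (use \<open>a \<le> x\<close> \<open>y \<le> b\<close> in \<open>auto intro: mono\<close>)
    have split: "integral {u..v} f = P v - P u" if "a \<le> u" "u \<le> v" "v \<le> b" for u v
      using Henstock_Kurzweil_Integration.integral_combine[of a u v f] that
        integrable_subinterval_real[OF f, of a v]
      by (auto simp: P_def)
    have "integral {a..y} (\<lambda>t. g t * f t) - integral {a..x} (\<lambda>t. g t * f t)
        = integral {x..y} (\<lambda>t. g t * f t)"
      using Henstock_Kurzweil_Integration.integral_combine[of a x y "\<lambda>t. g t * f t"] that
        integrable_subinterval_real[OF gf, of a y]
      by auto
    also have "\<dots> = g x * (P c - P x) + g y * (P y - P c)"
      using c that by (auto simp: integral_unique split)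
    finally show ?thesis
      using c(1) by (intro bexI[of _ c]) (auto simp: H_def algebra_simps)
  qed
  have "(H has_real_derivative g' x * P x) (at x within {a..b})" if x: "x \<in> {a..b}" for x
  proof -
    \<comment> \<open>The choice of \<open>c\<close> is uncontrolled except that it lies no farther
      from \<open>x\<close> than \<open>y\<close> does. This forces \<open>c y\<close> to tend to
      \<open>x\<close>, and continuity of \<open>P\<close> does the rest.\<close>
    have "\<exists>c. c \<in> {a..b} \<and> \<bar>c - x\<bar> \<le> \<bar>y - x\<bar> \<and> H y - H x = (g y - g x) * P c" if y: "y \<in> {a..b}" for y
    proof (cases "x \<le> y")
      case True
      with incr[of x y] x y obtain c where "c \<in> {x..y}" "H y - H x = (g y - g x) * P c"
        by auto
      with True x y show ?thesis by (intro exI[of _ c]) auto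
    next
      case False
      with incr[of y x] x y obtain c where "c \<in> {y..x}" "H x - H y = (g x - g y) * P c"
        by auto
      with False x y show ?thesis by (intro exI[of _ c]) (auto simp: algebra_simps)
    qed
    then obtain c where c: "\<And>y. y \<in> {a..b} \<Longrightarrow> c y \<in> {a..b}"
        "\<And>y. y \<in> {a..b} \<Longrightarrow> \<bar>c y - x\<bar> \<le> \<bar>y - x\<bar>"
        "\<And>y. y \<in> {a..b} \<Longrightarrow> H y - H x = (g y - g x) * P (c y)"
      by metis
    have ev: "\<forall>\<^sub>F y in at x within {a..b}. y \<in> {a..b}"
      by (simp add: eventually_at_filter)
    have "((\<lambda>y. \<bar>y - x\<bar>) \<longlongrightarrow> 0) (at x within {a..b})"
      by (rule tendsto_eq_intros refl | simp)+
    then have "((\<lambda>y. c y - x) \<longlongrightarrow> 0) (at x within {a..b})"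
      by (rule Lim_null_comparison[rotated]) (use ev c(2) in \<open>auto elim!: eventually_mono\<close>)
    then have "(c \<longlongrightarrow> x) (at x within {a..b})"
      by (simp add: LIM_zero_iff)
    then have "((\<lambda>y. P (c y)) \<longlongrightarrow> P x) (at x within {a..b})"
      by (rule continuous_on_tendsto_compose[OF contP _ x]) (use ev c(1) in \<open>auto elim!: eventually_mono\<close>)
    then have "((\<lambda>y. (g y - g x) / (y - x) * P (c y)) \<longlongrightarrow> g' x * P x) (at x within {a..b})"
      using g[OF x] unfolding has_field_derivative_iff by (intro tendsto_mult)
    then have "((\<lambda>y. (H y - H x) / (y - x)) \<longlongrightarrow> g' x * P x) (at x within {a..b})"
      by (rule Lim_transform_eventually) (use ev c(3) in \<open>auto elim!: eventually_mono\<close>)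
    then show ?thesis unfolding has_field_derivative_iff .
  qed
  then have "((\<lambda>x. g' x * P x) has_integral (H b - H a)) {a..b}"
    by (intro fundamental_theorem_of_calculus ab) (simp add: has_real_derivative_iff_has_vector_derivative)
  then show ?thesis
    by (simp add: H_def P_def)
qed

text \<open>Lerch's argument: the substitution x = exp(-t) carries the half-line to (0,1], where the
  hypothesis says that all moments of the transplanted function vanish. The limit of
  \<open>P\<close> at infinity supplies continuity at x = 0, so that Weierstrass approximation
  applies on the closed interval.\<close>

lemma continuous_laplace_unique:
  fixes P :: "real \<Rightarrow> real"
  assumes cont: "continuous_on {0..} P" and lim: "(P \<longlongrightarrow> 0) at_top"
    and moments: "\<And>n::nat. ((\<lambda>t. exp (- real (Suc n) * t) * P t) has_integral 0) {0..}"
    and "t \<ge> 0"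
  shows "P t = 0"
proof -
  \<comment> \<open>The value 0 at the left end is the limit of \<open>P\<close> at
    infinity.\<close>
  define psi where "psi = (\<lambda>x. if x \<le> 0 then 0 else P (- ln x))"
  have contpsi: "continuous_on {0..1} psi"
  proof (clarsimp simp: continuous_on_eq_continuous_within)
    fix x :: real assume x: "0 \<le> x" "x \<le> 1"
    show "continuous (at x within {0..1}) psi"
    proof (cases "x = 0")
      case True
      have "filterlim (\<lambda>x::real. - ln x) at_top (at_right 0)"
        by (simp add: filterlim_uminus_at_top ln_at_0)
      then have "((\<lambda>x. P (- ln x)) \<longlongrightarrow> 0) (at_right 0)"
        by (rule filterlim_compose[OF lim])
      then have "(psi \<longlongrightarrow> 0) (at_right 0)"
        by (rule Lim_transform_eventually) (auto simp: psi_def eventually_at_filter)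
      moreover have "at (0::real) within {0..1} = at_right 0"
        by (rule at_within_Icc_at_right) simp
      ultimately show ?thesis using True by (simp add: continuous_within psi_def)
    next
      case False
      have "continuous_on {0<..1} (\<lambda>x::real. P (- ln x))"
        by (intro continuous_on_compose2[OF cont] continuous_intros) auto
      then have "continuous (at x within {0<..1}) (\<lambda>x::real. P (- ln x))"
        using x False by (auto simp: continuous_on_eq_continuous_within)
      then have "continuous (at x within {0<..1}) psi"
        by (rule continuous_transform_within[OF _ zero_less_one]) (use x False in \<open>auto simp: psi_def\<close>)
      moreover have "at x within {0<..1} = at x within {0..1}"
        by (rule at_within_nhd[of x "{0<..}"]) (use x False in auto)
      ultimately show ?thesis by (simp add: continuous_within)
    qed
  qed
  have psiP: "psi (exp (-t)) = P t" for t by (simp add: psi_def)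
  obtain M where M: "\<And>x. x \<in> {0..1} \<Longrightarrow> \<bar>psi x\<bar> \<le> M"
    using compact_imp_bounded[OF compact_continuous_image[OF contpsi compact_Icc]]
    by (fastforce simp: bounded_iff)
  have PM: "\<bar>P t\<bar> \<le> M" if "t \<ge> 0" for t
    using M[of "exp (-t)"] that by (simp add: psiP)
  have M0: "M \<ge> 0" using PM[of 0] by simp
  have expint: "((\<lambda>t::real. exp (-t)) has_integral 1) {0..}"
    using has_integral_exp_minus_to_infinity[of 1 0] by simp
  have int: "(\<lambda>t. exp (-t) * (P t)\<^sup>2) integrable_on {0..}"
  proof (rule integrable_on_Ici_continuous_bound)
    show "continuous_on {0..} (\<lambda>t. exp (-t) * (P t)\<^sup>2)" by (intro continuous_intros cont)
    show "norm (exp (- x) * (P x)\<^sup>2) \<le> M\<^sup>2 * exp (-x)" if "x \<ge> 0" for x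
      using PM[of x] that M0 by (simp add: abs_le_square_iff[symmetric])
    show "(\<lambda>x. M\<^sup>2 * exp (-x)) integrable_on {0..}"
      using expint by (auto simp: integrable_on_def intro: has_integral_mult_right)
  qed
  \<comment> \<open>\<open>psi\<close> is \<open>P\<close> in the variable \<open>exp (- t)\<close>; approximate it by a polynomial, which is orthogonal to \<open>P\<close>.\<close>
  have small: "integral {0..} (\<lambda>t. exp (-t) * (P t)\<^sup>2) \<le> e * M" if e: "e > 0" for e
  proof -
    obtain q where q: "real_polynomial_function q" "\<And>x. x \<in> {0..1} \<Longrightarrow> \<bar>psi x - q x\<bar> < e"
      using Stone_Weierstrass_real_polynomial_function[OF compact_Icc contpsi e] by blast
    then obtain c n where cn: "q = (\<lambda>x. \<Sum>i\<le>n. c i * x ^ i)"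
      by (auto simp: real_polynomial_function_iff_sum)
    have "((\<lambda>t. \<Sum>i\<le>n. c i * (exp (- real (Suc i) * t) * P t)) has_integral (\<Sum>i\<le>n. c i * 0)) {0..}"
      by (intro has_integral_sum has_integral_mult_right moments) auto
    moreover have "(\<Sum>i\<le>n. c i * (exp (- real (Suc i) * t) * P t)) = exp (-t) * P t * q (exp (-t))" for t
    proof -
      \<comment> \<open>One of the \<open>Suc i\<close> factors is the Jacobian of x = exp(-t); the
        other \<open>i\<close> form the monomial.\<close>
      have "exp (- real (Suc i) * t) = exp (-t) * exp (-t) ^ i" for i
        by (metis exp_of_nat_mult mult_minus_left mult_minus_right power_Suc)
      then show ?thesis
        by (simp add: cn sum_distrib_left mult_ac)
    qed
    ultimately have q0: "((\<lambda>t. exp (-t) * P t * q (exp (-t))) has_integral 0) {0..}"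
      by simp
    have "((\<lambda>t. exp (-t) * (P t)\<^sup>2 - exp (-t) * P t * q (exp (-t)))
        has_integral (integral {0..} (\<lambda>t. exp (-t) * (P t)\<^sup>2) - 0)) {0..}"
      by (intro has_integral_diff q0 integrable_integral int)
    then have "integral {0..} (\<lambda>t. exp (-t) * (P t)\<^sup>2) - 0 \<le> e * M"
    proof (rule has_integral_le[where g = "\<lambda>t. e * M * exp (-t)"])
      show "((\<lambda>t. e * M * exp (-t)) has_integral e * M) {0..}"
        using has_integral_mult_right[OF expint, of "e * M"] by simp
      fix t :: real assume "t \<in> {0..}"
      then have t: "t \<ge> 0" by simp
      have "exp (-t) * (P t)\<^sup>2 - exp (-t) * P t * q (exp (-t)) = exp (-t) * (P t * (psi (exp (-t)) - q (exp (-t))))"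
        by (simp add: psiP algebra_simps power2_eq_square)
      also have "\<dots> \<le> exp (-t) * (M * e)"
      proof (rule mult_left_mono)
        have "P t * (psi (exp (-t)) - q (exp (-t))) \<le> \<bar>P t\<bar> * \<bar>psi (exp (-t)) - q (exp (-t))\<bar>"
          by (metis abs_ge_self abs_mult)
        also have "\<dots> \<le> M * e"
          by (intro mult_mono PM t M0 less_imp_le[OF q(2)]) (use t in auto)
        finally show "P t * (psi (exp (-t)) - q (exp (-t))) \<le> M * e" .
      qed simp
      finally show "exp (-t) * (P t)\<^sup>2 - exp (-t) * P t * q (exp (-t)) \<le> e * M * exp (-t)"
        by (simp add: mult_ac)
    qed
    then show ?thesis by simp
  qed
  have le0: "integral {0..} (\<lambda>t. exp (-t) * (P t)\<^sup>2) \<le> 0"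
  proof (rule field_le_epsilon)
    fix d :: real assume "d > 0"
    \<comment> \<open>The denominator \<open>M + 1\<close> avoids division by zero, since
      \<open>M\<close> may be 0.\<close>
    have "integral {0..} (\<lambda>t. exp (-t) * (P t)\<^sup>2) \<le> d / (M + 1) * M"
      using small[of "d / (M + 1)"] \<open>d > 0\<close> M0 by simp
    also have "\<dots> \<le> d" using \<open>d > 0\<close> M0 by (simp add: field_simps)
    finally show "integral {0..} (\<lambda>t. exp (-t) * (P t)\<^sup>2) \<le> 0 + d" by simp
  qed
  \<comment> \<open>A nonnegative continuous integrand with integral 0 vanishes. The endpoint
    \<open>t+1\<close> keeps the interval nondegenerate when \<open>t\<close> is 0.\<close>
  let ?f = "\<lambda>t. exp (-t) * (P t)\<^sup>2"
  have c1: "?f integrable_on {0..t+1}"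
    by (intro integrable_continuous_interval continuous_intros continuous_on_subset[OF cont]) auto
  have "integral {0..t+1} ?f \<le> integral {0..} ?f"
    by (rule integral_subset_le) (use int c1 in auto)
  moreover have "integral {0..t+1} ?f \<ge> 0"
    by (rule integral_nonneg[OF c1]) auto
  ultimately have "integral {0..t+1} ?f = 0"
    using le0 by linarith
  then have "(?f has_integral 0) (cbox 0 (t+1))"
    using integrable_integral[OF c1] by simp
  moreover have "continuous_on (cbox 0 (t+1)) ?f"
    by (intro continuous_intros continuous_on_subset[OF cont]) auto
  ultimately have "?f t = 0"
    by (intro has_integral_0_cbox_imp_0[of 0 "t+1" ?f]) (use \<open>t \<ge> 0\<close> in auto)
  then show ?thesis by simp
qed

text \<open>A merely gauge integrable \<open>f\<close> is replaced by the continuous indefinite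
  integral \<open>P\<close> of exp(-a t) f(t). The hypothesis at s = a says that \<open>P\<close>
  tends to 0 at infinity; integration by parts turns the hypothesis at a + s into the vanishing of
  the transform of \<open>P\<close> at each s > 0. Lerch's argument gives P = 0, and differentiation
  recovers \<open>f\<close> almost everywhere.\<close>

lemma laplace_unique_real:
  fixes f :: "real \<Rightarrow> real"
  assumes zero: "\<And>s. s \<ge> a \<Longrightarrow> ((\<lambda>t. exp (- s * t) * f t) has_integral 0) {0..}"
  shows "negligible {t \<in> {0..}. f t \<noteq> 0}"
proof -
  define g where "g = (\<lambda>t. exp (- a * t) * f t)"
  define P where "P = (\<lambda>t. integral {0..t} g)"
  have g: "(g has_integral 0) {0..}" unfolding g_def by (rule zero) simp
  then have gint: "g integrable_on {0..T}" for T
    by (intro integrable_on_subinterval[of g "{0..}"]) auto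
  have lim: "(P \<longlongrightarrow> 0) at_top"
    unfolding P_def by (rule has_integral_Ici_tendsto[OF g])
  have cont: "continuous_on {0..} P"
  proof (clarsimp simp: continuous_on_eq_continuous_within)
    fix x :: real assume "0 \<le> x"
    have "continuous_on {0..x+1} P"
      unfolding P_def by (rule indefinite_integral_continuous_1[OF gint])
    then have "continuous (at x within {0..x+1}) P"
      using \<open>0 \<le> x\<close> by (auto simp: continuous_on_eq_continuous_within)
    moreover have "at x within {0..x+1} = at x within {0..}"
      by (rule at_within_nhd[of x "{..<x+1}"]) (use \<open>0 \<le> x\<close> in auto)
    ultimately show "continuous (at x within {0..}) P" by (simp add: continuous_within)
  qed
  have parts: "integral {0..T} (\<lambda>t. exp (- s * t) * P t) =
      (integral {0..T} (\<lambda>t. exp (- s * t) * g t) - exp (- s * T) * P T) / s"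
    if "s > 0" "T \<ge> 0" for s T
  proof -
    \<comment> \<open>The weight is -exp(-s t) rather than exp(-s t), because the integration by
      parts is stated for increasing weights.\<close>
    have "((\<lambda>t. (s * exp (- s * t)) * integral {0..t} g) has_integral
        (- exp (- s * T)) * integral {0..T} g - integral {0..T} (\<lambda>t. (- exp (- s * t)) * g t)) {0..T}"
      by (rule integration_by_parts_gauge[OF gint \<open>T \<ge> 0\<close>])
         (use \<open>s > 0\<close> in \<open>auto intro!: derivative_eq_intros\<close>)
    then have "((\<lambda>t. inverse s * ((s * exp (- s * t)) * P t)) has_integral inverse s *
        ((- exp (- s * T)) * P T - integral {0..T} (\<lambda>t. (- exp (- s * t)) * g t))) {0..T}"
      unfolding P_def by (rule has_integral_mult_right)
    then have "integral {0..T} (\<lambda>t. inverse s * ((s * exp (- s * t)) * P t)) = inverse s *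
        ((- exp (- s * T)) * P T - integral {0..T} (\<lambda>t. (- exp (- s * t)) * g t))"
      by (rule integral_unique)
    then show ?thesis using \<open>s > 0\<close> by (simp add: field_simps)
  qed
  have Pint: "((\<lambda>t. exp (- s * t) * P t) has_integral 0) {0..}" if "s > 0" for s
  proof -
    obtain M where M: "\<And>t. t \<ge> 0 \<Longrightarrow> \<bar>P t\<bar> \<le> M"
    proof -
      obtain T where T: "\<And>t. t \<ge> T \<Longrightarrow> \<bar>P t\<bar> < 1"
        using tendstoD[OF lim, of 1] by (auto simp: eventually_at_top_linorder)
      have "continuous_on {0..T} P" by (rule continuous_on_subset[OF cont]) auto
      then obtain K where K: "\<And>t. t \<in> {0..T} \<Longrightarrow> \<bar>P t\<bar> \<le> K"
        using compact_imp_bounded[OF compact_continuous_image[OF _ compact_Icc]]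
        by (fastforce simp: bounded_iff)
      have "\<bar>P t\<bar> \<le> max 1 K" if "t \<ge> 0" for t
        using T[of t] K[of t] that by (cases "t \<le> T") auto
      then show ?thesis using that by blast
    qed
    have int: "(\<lambda>t. exp (- s * t) * P t) integrable_on {0..}"
    proof (rule integrable_on_Ici_continuous_bound)
      show "continuous_on {0..} (\<lambda>t. exp (- s * t) * P t)" by (intro continuous_intros cont)
      show "norm (exp (- s * x) * P x) \<le> M * exp (- s * x)" if "x \<ge> 0" for x
        using M[of x] that by (simp add: abs_mult mult.commute)
      show "(\<lambda>x. M * exp (- s * x)) integrable_on {0..}"
        using has_integral_exp_minus_to_infinity[OF \<open>s > 0\<close>, of 0]
        by (auto simp: integrable_on_def intro: has_integral_mult_right)
    qed
    have sg: "((\<lambda>t. exp (- s * t) * g t) has_integral 0) {0..}"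
      using zero[of "a + s"] \<open>s > 0\<close> by (simp add: g_def exp_add algebra_simps exp_diff exp_minus field_simps)
    have "((\<lambda>T. exp (- s * T)) \<longlongrightarrow> 0) at_top"
      using \<open>s > 0\<close> by real_asymp
    then have "((\<lambda>T. (integral {0..T} (\<lambda>t. exp (- s * t) * g t) - exp (- s * T) * P T) / s) \<longlongrightarrow> (0 - 0 * 0) / s) at_top"
      by (intro tendsto_intros has_integral_Ici_tendsto[OF sg] lim) (use \<open>s > 0\<close> in auto)
    moreover have "\<forall>\<^sub>F T in at_top. (integral {0..T} (\<lambda>t. exp (- s * t) * g t) - exp (- s * T) * P T) / s =
        integral {0..T} (\<lambda>t. exp (- s * t) * P t)"
      by (rule eventually_at_top_linorderI[of 0]) (use parts \<open>s > 0\<close> in auto)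
    ultimately have "((\<lambda>T. integral {0..T} (\<lambda>t. exp (- s * t) * P t)) \<longlongrightarrow> (0 - 0 * 0) / s) at_top"
      by (rule Lim_transform_eventually)
    then have "((\<lambda>T. integral {0..T} (\<lambda>t. exp (- s * t) * P t)) \<longlongrightarrow> 0) at_top"
      by simp
    moreover have "((\<lambda>T. integral {0..T} (\<lambda>t. exp (- s * t) * P t)) \<longlongrightarrow> integral {0..} (\<lambda>t. exp (- s * t) * P t)) at_top"
      by (rule has_integral_Ici_tendsto[OF integrable_integral[OF int]])
    ultimately have "integral {0..} (\<lambda>t. exp (- s * t) * P t) = 0"
      using tendsto_unique[OF trivial_limit_at_top_linorder] by blast
    then show ?thesis using integrable_integral[OF int] by simp
  qed
  have P0: "P t = 0" if "t \<ge> 0" for t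
    by (rule continuous_laplace_unique[OF cont lim Pint that]) simp
  have "negligible {t \<in> {0..}. g t \<noteq> 0}"
  proof (rule negligible_of_zero_integrals)
    show "(g has_integral 0) {0..t}" if "t \<ge> 0" for t
      using integrable_integral[OF gint, of t] P0[OF that] by (simp add: P_def)
  qed
  then show ?thesis by (simp add: g_def)
qed

text \<open>Strong measurability makes the range almost separable; testing with a countable dense set of
  vectors keeps the exceptional set null. The space itself may be nonseparable, and then weak
  nullity alone would not suffice.\<close>

lemma measurable_on_negligible_of_inner:
  fixes f :: "real \<Rightarrow> 'a::real_inner"
  assumes meas: "f measurable_on S"
    and weak: "\<And>v. negligible {t \<in> S. f t \<bullet> v \<noteq> 0}"
  shows "negligible {t \<in> S. f t \<noteq> 0}"
proof -
  obtain N g where N: "negligible N" and g: "\<And>n. continuous_on UNIV (g n)"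
    and lim: "\<And>x. x \<notin> N \<Longrightarrow> (\<lambda>n::nat. g n x) \<longlonglongrightarrow> (if x \<in> S then f x else 0)"
    using meas unfolding measurable_on_def by blast
  define D where "D = (\<Union>n. g n ` \<rat>)"
  have "countable D" unfolding D_def by (intro countable_UN countable_image countable_rat) auto
  define Z where "Z = N \<union> (\<Union>v\<in>D. {t \<in> S. f t \<bullet> v \<noteq> 0})"
  have negZ: "negligible Z"
    unfolding Z_def using \<open>countable D\<close> N weak
    by (auto intro!: negligible_Un negligible_countable_Union)
  have "f t = 0" if t: "t \<in> S" "t \<notin> Z" for t
  proof -
    have "g n t \<in> closure D" for n
    proof -
      have "g n ` closure \<rat> \<subseteq> closure (g n ` \<rat>)"
        by (rule image_closure_subset) (use g in \<open>auto intro: continuous_on_subset closure_subset[THEN subsetD]\<close>)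
      also have "\<dots> \<subseteq> closure D" by (rule closure_mono) (auto simp: D_def)
      finally show ?thesis by (auto simp: Rats_closure_real)
    qed
    moreover have "(\<lambda>n. g n t) \<longlonglongrightarrow> f t" using lim[of t] t by (auto simp: Z_def)
    ultimately have "f t \<in> closure D"
      by (metis closed_closure closed_sequentially)
    \<comment> \<open>The orthogonal complement of \<open>f t\<close> is closed and contains
      \<open>D\<close>; since \<open>f t\<close> lies in the closure of \<open>D\<close>, it is
      orthogonal to itself.\<close>
    moreover have "closure D \<subseteq> {v. f t \<bullet> v = 0}"
    proof (rule closure_minimal)
      show "D \<subseteq> {v. f t \<bullet> v = 0}" using t by (auto simp: Z_def)
      show "closed {v. f t \<bullet> v = 0}" by (intro closed_Collect_eq continuous_intros)
    qed
    ultimately show ?thesis by auto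
  qed
  then show ?thesis by (intro negligible_subset[OF negZ]) auto
qed

lemma null_signal_of_laplace_zero:
  fixes u :: "real \<Rightarrow> 'a::{real_inner, banach}"
  assumes meas: "u measurable_on {0..}" and lap: "has_laplace u U"
    and zero: "\<forall>\<^sub>F s in right_half_planes. U s = 0"
  shows "null_signal u"
  unfolding null_signal_def
proof (rule measurable_on_negligible_of_inner[OF meas])
  fix v
  have "\<forall>\<^sub>F s in right_half_planes.
      ((\<lambda>t. cscale (exp (- s * of_real t)) (u t, 0)) has_integral 0) {0..}"
    using lap[unfolded has_laplace_def] zero by eventually_elim simp
  then obtain b where b: "\<And>s. Re s \<ge> b \<Longrightarrow>
      ((\<lambda>t. cscale (exp (- s * of_real t)) (u t, 0)) has_integral 0) {0..}"
    by (auto simp: right_half_planes_def eventually_filtercomap eventually_at_top_linorder)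
  show "negligible {t \<in> {0..}. u t \<bullet> v \<noteq> 0}"
  proof (rule laplace_unique_real)
    fix s :: real assume "s \<ge> b"
    have bl: "bounded_linear (\<lambda>x :: 'a complexified. fst x \<bullet> v)"
      by (rule bounded_linear_compose[OF bounded_linear_inner_left bounded_linear_fst])
    have e: "exp (- (of_real s * of_real t) :: complex) = of_real (exp (- s * t))" for t
      by (simp flip: exp_of_real)
    show "((\<lambda>t. exp (- s * t) * (u t \<bullet> v)) has_integral 0) {0..}"
      using has_integral_linear[OF b[of "of_real s"] bl] \<open>s \<ge> b\<close>
      by (simp add: o_def e cscale_def)
  qed
qed

section \<open>Line integrals in a half-plane\<close>

lemma integrable_on_UNIV_continuous_bound:
  fixes f :: "real \<Rightarrow> 'a::banach"
  assumes cont: "continuous_on UNIV f" and g: "g integrable_on UNIV"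
    and le: "\<And>x. norm (f x) \<le> g x"
  shows "f integrable_on UNIV"
proof (rule integrable_on_all_intervals_integrable_bound[OF _ _ g])
  show "(\<lambda>x. if x \<in> UNIV then f x else 0) integrable_on cbox c d" for c d
    by (simp add: integrable_continuous_interval continuous_on_subset[OF cont])
qed (use le in auto)

lemma integrable_inverse_1_plus_square_lborel:
  "integrable lborel (\<lambda>x::real. inverse (1 + x\<^sup>2))"
  using integrable_inverse_1_plus_square by (simp add: set_integrable_def einterval_def)

lemma cmod_Complex_power4: "cmod (Complex 1 w) ^ 4 = (1 + w\<^sup>2)\<^sup>2"
proof -
  have "cmod (Complex 1 w) ^ 4 = ((cmod (Complex 1 w))\<^sup>2)\<^sup>2" by simp
  also have "\<dots> = (1 + w\<^sup>2)\<^sup>2" by (simp only: cmod_power2) simp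
  finally show ?thesis .
qed

text \<open>On the line Re s = a + 1 the difference s - a is 1 + i w, which never vanishes. The
  weaker bound serves for integrability; the stronger one keeps a spare factor for the Lipschitz
  estimate.\<close>

lemma vertical_line_bound:
  assumes "norm x \<le> M / cmod (Complex (a + 1) w - of_real a) ^ 4"
  shows "norm x \<le> M * (inverse (1 + w\<^sup>2))\<^sup>2" "norm x \<le> M * inverse (1 + w\<^sup>2)"
proof -
  have eq: "Complex (a + 1) w - of_real a = Complex 1 w" by (simp add: complex_eq_iff)
  show 1: "norm x \<le> M * (inverse (1 + w\<^sup>2))\<^sup>2"
    using assms unfolding eq cmod_Complex_power4 by (simp add: divide_inverse power_inverse)
  have pos: "(0::real) < 1 + w\<^sup>2" by (simp add: add_pos_nonneg)
  have "0 \<le> M * (inverse (1 + w\<^sup>2))\<^sup>2" using 1 norm_ge_zero order_trans by blast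
  then have "M \<ge> 0" using pos by (simp add: zero_le_mult_iff)
  moreover have "(inverse (1 + w\<^sup>2))\<^sup>2 \<le> inverse (1 + w\<^sup>2)"
    using pos by (simp add: power2_eq_square mult_left_le inverse_le_1_iff)
  ultimately show "norm x \<le> M * inverse (1 + w\<^sup>2)"
    using 1 by (meson mult_left_mono order_trans)
qed

text \<open>Cauchy's formula on a rectangle whose left edge lies on the line Re s = a + 1. The other
  three edges have length at most 2 R and the integrand there is at most M / R^4, so only the line
  survives as R grows.\<close>

lemma half_plane_cauchy:
  assumes hol: "G holomorphic_on {s. Re s > a}"
    and bound: "\<And>s. Re s \<ge> a + 1 \<Longrightarrow> norm (G s) \<le> M / cmod (s - of_real a) ^ 4"
    and s0: "Re s0 > a + 1"
  shows "((\<lambda>w. G (Complex (a + 1) w) / (s0 - Complex (a + 1) w)) has_integral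
    (2 * of_real pi * G s0)) UNIV"
proof -
  define f where "f = (\<lambda>z. G z / (z - s0))"
  define g where "g = (\<lambda>w. G (Complex (a + 1) w) / (s0 - Complex (a + 1) w))"
  have M0: "M \<ge> 0"
  proof -
    have "0 \<le> M / cmod (s0 - of_real a) ^ 4"
      by (rule order_trans[OF norm_ge_zero bound]) (use s0 in simp)
    moreover have "cmod (s0 - of_real a) > 0" using s0 by auto
    ultimately show ?thesis by (simp add: zero_le_divide_iff)
  qed
  have contG: "continuous_on {s. Re s > a} G" using hol by (rule holomorphic_on_imp_continuous_on)
  have contg: "continuous_on UNIV g"
    unfolding g_def
    by (intro continuous_intros continuous_on_compose2[OF contG]) (use s0 in \<open>auto simp: complex_eq_iff\<close>)
  have gint: "g integrable_on UNIV"
  proof (rule integrable_on_UNIV_continuous_bound[OF contg])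
    let ?d = "Re s0 - (a + 1)"
    show "(\<lambda>w::real. M / ?d * inverse (1 + w\<^sup>2)) integrable_on UNIV"
      using integrable_on_lborel[OF integrable_inverse_1_plus_square_lborel]
      by (rule integrable_on_mult_right)
    show "norm (g w) \<le> M / ?d * inverse (1 + w\<^sup>2)" for w
    proof -
      have "norm (G (Complex (a + 1) w)) \<le> M * inverse (1 + w\<^sup>2)"
        by (rule vertical_line_bound(2)[OF bound]) simp
      moreover have "?d \<le> cmod (s0 - Complex (a + 1) w)"
        using complex_Re_le_cmod[of "s0 - Complex (a + 1) w"] by simp
      ultimately have "norm (g w) \<le> (M * inverse (1 + w\<^sup>2)) / ?d"
        unfolding g_def norm_divide
        using s0 M0 by (intro frac_le) (auto simp: add_nonneg_nonneg)
      then show ?thesis by simp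
    qed
  qed
  have lim1: "((\<lambda>R. integral {-R..R} g) \<longlongrightarrow> integral UNIV g) at_top"
    by (rule has_integral_UNIV_tendsto[OF integrable_integral[OF gint]])
  \<comment> \<open>From this size on the rectangle encloses \<open>s0\<close> and its three far
    edges stay at distance at least 1 from \<open>s0\<close> and at least \<open>R\<close> from
    \<open>a\<close>.\<close>
  define R0 where "R0 = cmod s0 + \<bar>a\<bar> + 2"
  have est: "norm (integral {-R..R} g - 2 * of_real pi * G s0) \<le> 6 * M / R ^ 3" if R: "R \<ge> R0" for R
  proof -
    have R_pos: "R \<ge> 2" using R norm_ge_zero[of s0] unfolding R0_def by linarith
    define z1 z2 z3 z4 where "z1 = Complex (a + 1) (-R)" and "z2 = Complex (a + 1 + R) (-R)"
      and "z3 = Complex (a + 1 + R) R" and "z4 = Complex (a + 1) R"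
    note z_defs = z1_def z2_def z3_def z4_def
    have s0b: "\<bar>Re s0\<bar> \<le> R - 2 - \<bar>a\<bar>" "\<bar>Im s0\<bar> \<le> R - 2 - \<bar>a\<bar>"
      using R abs_Re_le_cmod[of s0] abs_Im_le_cmod[of s0] by (auto simp: R0_def)
    have box: "s0 \<in> box z1 z3"
      unfolding in_box_complex_iff greaterThanLessThan_iff z1_def z3_def complex.sel using s0 s0b by (intro conjI) linarith+
    have cb: "path_image (rectpath z1 z3) \<subseteq> {s. Re s > a} - {s0}"
    proof -
      have "path_image (rectpath z1 z3) = cbox z1 z3 - box z1 z3"
        by (rule path_image_rectpath_cbox_minus_box) (use R_pos in \<open>auto simp: z_defs\<close>)
      moreover have "cbox z1 z3 \<subseteq> {s. Re s > a}"
        by (auto simp: in_cbox_complex_iff z1_def)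
      ultimately show ?thesis using box by blast
    qed
    have "(f has_contour_integral (2 * pi * \<i> * winding_number (rectpath z1 z3) s0 * G s0)) (rectpath z1 z3)"
      unfolding f_def
    proof (rule Cauchy_integral_formula_convex_simple[OF _ hol _ _ cb])
      show "convex {s. Re s > a}" by (rule convex_halfspace_Re_gt)
      show "s0 \<in> interior {s. Re s > a}"
        using s0 by (simp add: interior_open open_halfspace_Re_gt)
    qed auto
    then have cauchy: "contour_integral (rectpath z1 z3) f = 2 * pi * \<i> * G s0"
      unfolding winding_number_rectpath[OF box] of_real_1 mult_1_right by (rule contour_integral_unique)
    have z24: "Complex (Re z3) (Im z1) = z2" "Complex (Re z1) (Im z3) = z4" by (simp_all add: z_defs)
    have contf: "continuous_on ({s. Re s > a} - {s0}) f"
      unfolding f_def by (intro continuous_intros continuous_on_subset[OF contG]) auto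
    have segs: "closed_segment z1 z2 \<subseteq> path_image (rectpath z1 z3)"
      "closed_segment z2 z3 \<subseteq> path_image (rectpath z1 z3)"
      "closed_segment z3 z4 \<subseteq> path_image (rectpath z1 z3)"
      "closed_segment z4 z1 \<subseteq> path_image (rectpath z1 z3)"
      unfolding rectpath_def Let_def z24 by (simp_all add: path_image_join le_supI1 le_supI2)
    have int: "f contour_integrable_on linepath z1 z2" "f contour_integrable_on linepath z2 z3"
      "f contour_integrable_on linepath z3 z4" "f contour_integrable_on linepath z4 z1"
      by (intro contour_integrable_continuous_linepath continuous_on_subset[OF contf]
          order_trans[OF segs(1) cb] order_trans[OF segs(2) cb] order_trans[OF segs(3) cb]
          order_trans[OF segs(4) cb])+
    have sum: "contour_integral (rectpath z1 z3) f = contour_integral (linepath z1 z2) f +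
       (contour_integral (linepath z2 z3) f + (contour_integral (linepath z3 z4) f +
        contour_integral (linepath z4 z1) f))"
      using int by (simp add: rectpath_def Let_def z24)
    \<comment> \<open>Two signs cancel here: the edge is traversed downwards, and \<open>f\<close>
      is \<open>- g\<close> on it because the denominator of \<open>g\<close> is
      \<open>s0 - z\<close>.\<close>
    have left: "contour_integral (linepath z4 z1) f = \<i> * integral {-R..R} g"
    proof -
      have ct: "f contour_integrable_on linepath z1 z4"
        using segs(4) cb closed_segment_commute[of z1 z4]
        by (intro contour_integrable_continuous_linepath continuous_on_subset[OF contf]) blast
      have "((\<lambda>x. f (Complex (a + 1) x)) has_integral (- \<i> * contour_integral (linepath z1 z4) f)) {-R..R}"
        by (rule has_contour_integral_linepath_same_Re_iff[THEN iffD1])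
           (use R_pos has_contour_integral_integral[OF ct] in \<open>auto simp: z_defs\<close>)
      moreover have fg: "(\<lambda>x. f (Complex (a + 1) x)) = (\<lambda>x. - g x)"
        by (simp add: f_def g_def minus_divide_right)
      ultimately have "((\<lambda>x. - g x) has_integral (- \<i> * contour_integral (linepath z1 z4) f)) {-R..R}"
        by (simp only:)
      then have "integral {-R..R} (\<lambda>x. - g x) = - \<i> * contour_integral (linepath z1 z4) f"
        by (rule integral_unique)
      then have eq: "integral {-R..R} g = \<i> * contour_integral (linepath z1 z4) f" by simp
      have rev: "contour_integral (linepath z4 z1) f = - contour_integral (linepath z1 z4) f"
        using contour_integral_reversepath[of "linepath z1 z4" f] by simp
      show ?thesis unfolding rev eq by simp
    qed
    have fb: "norm (f z) \<le> M / R ^ 4" if z: "Re z \<ge> a + 1" "Re z - a \<ge> R \<or> \<bar>Im z\<bar> \<ge> R" for z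
    proof -
      have "cmod (z - of_real a) \<ge> R"
        using z abs_Re_le_cmod[of "z - of_real a"] abs_Im_le_cmod[of "z - of_real a"] by auto
      then have "M / cmod (z - of_real a) ^ 4 \<le> M / R ^ 4"
        by (intro frac_le power_mono) (use R_pos M0 in auto)
      moreover have "cmod (z - s0) \<ge> 1"
        using z s0b abs_Re_le_cmod[of "z - s0"] abs_Im_le_cmod[of "z - s0"] by auto
      ultimately have "norm (G z) / cmod (z - s0) \<le> (M / R ^ 4) / 1"
        using bound[of z] z M0 R_pos by (intro frac_le) auto
      then show ?thesis by (simp add: f_def norm_divide)
    qed
    have edge: "norm (contour_integral (linepath p q) f) \<le> 2 * M / R ^ 3"
      if pq: "f contour_integrable_on linepath p q" "norm (q - p) \<le> 2 * R"
        "\<And>z. z \<in> closed_segment p q \<Longrightarrow> norm (f z) \<le> M / R ^ 4" for p q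
    proof -
      have "norm (contour_integral (linepath p q) f) \<le> M / R ^ 4 * norm (q - p)"
        by (rule has_contour_integral_bound_linepath[OF has_contour_integral_integral[OF pq(1)]])
           (use pq M0 R_pos in auto)
      also have "\<dots> \<le> M / R ^ 4 * (2 * R)"
        by (rule mult_left_mono) (use pq M0 R_pos in auto)
      also have "\<dots> = 2 * M / R ^ 3" using R_pos by (simp add: field_simps eval_nat_numeral)
      finally show ?thesis .
    qed
    have "norm (contour_integral (linepath z1 z2) f) \<le> 2 * M / R ^ 3"
    proof (rule edge[OF int(1)])
      show "norm (z2 - z1) \<le> 2 * R"
        using cmod_le[of "z2 - z1"] R_pos by (simp add: z_defs)
      fix z assume "z \<in> closed_segment z1 z2"
      then show "norm (f z) \<le> M / R ^ 4"
        by (intro fb) (use R_pos in \<open>auto simp: z_defs closed_segment_same_Im closed_segment_eq_real_ivl\<close>)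
    qed
    moreover have "norm (contour_integral (linepath z2 z3) f) \<le> 2 * M / R ^ 3"
    proof (rule edge[OF int(2)])
      show "norm (z3 - z2) \<le> 2 * R"
        using cmod_le[of "z3 - z2"] R_pos by (simp add: z_defs)
      fix z assume "z \<in> closed_segment z2 z3"
      then show "norm (f z) \<le> M / R ^ 4"
        by (intro fb) (use R_pos in \<open>auto simp: z_defs closed_segment_same_Re closed_segment_eq_real_ivl\<close>)
    qed
    moreover have "norm (contour_integral (linepath z3 z4) f) \<le> 2 * M / R ^ 3"
    proof (rule edge[OF int(3)])
      show "norm (z4 - z3) \<le> 2 * R"
        using cmod_le[of "z4 - z3"] R_pos by (simp add: z_defs)
      fix z assume "z \<in> closed_segment z3 z4"
      then show "norm (f z) \<le> M / R ^ 4"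
        by (intro fb) (use R_pos in \<open>auto simp: z_defs closed_segment_same_Im closed_segment_eq_real_ivl\<close>)
    qed
    moreover have "\<i> * (integral {-R..R} g - 2 * of_real pi * G s0) = - (contour_integral (linepath z1 z2) f +
        contour_integral (linepath z2 z3) f + contour_integral (linepath z3 z4) f)"
      using cauchy sum left by (simp add: algebra_simps)
    then have "norm (integral {-R..R} g - 2 * of_real pi * G s0) = norm (contour_integral (linepath z1 z2) f +
        contour_integral (linepath z2 z3) f + contour_integral (linepath z3 z4) f)"
      using norm_mult[of \<i> "integral {-R..R} g - 2 * of_real pi * G s0"] by (simp only: norm_minus_cancel norm_ii mult_1)
    moreover have "norm (contour_integral (linepath z1 z2) f + contour_integral (linepath z2 z3) f +
        contour_integral (linepath z3 z4) f) \<le> norm (contour_integral (linepath z1 z2) f) +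
        norm (contour_integral (linepath z2 z3) f) + norm (contour_integral (linepath z3 z4) f)"
      by (intro norm_triangle_mono order_refl)
    moreover have "6 * M / R ^ 3 = 2 * M / R ^ 3 + 2 * M / R ^ 3 + 2 * M / R ^ 3"
      by (simp add: add_divide_distrib[symmetric])
    ultimately show ?thesis
      by linarith
  qed
  have "((\<lambda>R. integral {-R..R} g - 2 * of_real pi * G s0) \<longlongrightarrow> 0) at_top"
  proof (rule Lim_null_comparison)
    show "\<forall>\<^sub>F R in at_top. norm (integral {-R..R} g - 2 * of_real pi * G s0) \<le> 6 * M / R ^ 3"
      using est by (rule eventually_at_top_linorderI)
    show "((\<lambda>R. 6 * M / R ^ 3) \<longlongrightarrow> 0) at_top" by real_asymp
  qed
  then have "((\<lambda>R. integral {-R..R} g) \<longlongrightarrow> 2 * of_real pi * G s0) at_top"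
    by (simp add: LIM_zero_iff)
  \<comment> \<open>The symmetric limit alone would be a principal value; absolute integrability of
    \<open>g\<close> identifies it with the integral over the whole line.\<close>
  from tendsto_unique[OF trivial_limit_at_top_linorder lim1 this]
  have "integral UNIV g = 2 * of_real pi * G s0" .
  then show ?thesis using integrable_integral[OF gint] by (simp add: g_def)
qed

text \<open>Stated for the Lebesgue integral over the whole line, with an indicator, because this is
  the inner integral in an application of Fubini's theorem.\<close>

lemma has_integral_exp_Ici:
  fixes w :: complex
  assumes w: "Re w > 0"
  shows "integrable lborel (\<lambda>t. indicat_real {0..} t *\<^sub>R exp (- w * of_real t))"
    and "(LINT t|lborel. indicat_real {0..} t *\<^sub>R exp (- w * of_real t)) = 1 / w"
proof -
  let ?e = "\<lambda>t::real. exp (- w * of_real t)"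
  have "(\<lambda>t. exp (- Re w * t)) absolutely_integrable_on {0..}"
    using has_integral_exp_minus_to_infinity[OF w, of 0]
    by (intro nonnegative_absolutely_integrable_1) auto
  then have "integrable lborel (\<lambda>t. indicat_real {0..} t *\<^sub>R exp (- Re w * t))"
    by (simp add: set_integrable_def integrable_completion)
  then show int: "integrable lborel (\<lambda>t. indicat_real {0..} t *\<^sub>R ?e t)"
    by (rule Bochner_Integration.integrable_bound) (auto simp: indicator_def)
  have hi: "((\<lambda>t. indicat_real {0..} t *\<^sub>R ?e t) has_integral
      (LINT t|lborel. indicat_real {0..} t *\<^sub>R ?e t)) UNIV"
    by (rule has_integral_integral_lborel[OF int])
  have "((\<lambda>t. if t \<in> {0..} then ?e t else 0) has_integral
      (LINT t|lborel. indicat_real {0..} t *\<^sub>R ?e t)) UNIV"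
    by (rule has_integral_eq[OF _ hi]) (simp add: indicator_def)
  then have "(?e has_integral (LINT t|lborel. indicat_real {0..} t *\<^sub>R ?e t)) {0..}"
    by (simp only: has_integral_restrict_UNIV)
  then have lim: "((\<lambda>T. integral {0..T} ?e) \<longlongrightarrow> (LINT t|lborel. indicat_real {0..} t *\<^sub>R ?e t)) at_top"
    by (rule has_integral_Ici_tendsto)
  have w0: "w \<noteq> 0" using w by auto
  have eq: "integral {0..T} ?e = (1 - ?e T) / w" if "T \<ge> 0" for T
  proof -
    have "(?e has_integral ((- ?e T / w) - (- ?e 0 / w))) {0..T}"
    proof (rule fundamental_theorem_of_calculus[OF that])
      fix x :: real
      have "((\<lambda>z. - exp (- w * z) / w) has_field_derivative ?e x) (at (of_real x))"
        using w0 by (auto intro!: derivative_eq_intros)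
      then show "((\<lambda>x. - ?e x / w) has_vector_derivative ?e x) (at x within {0..T})"
        by (rule has_vector_derivative_real_field)
    qed
    then show ?thesis using w0 by (simp add: integral_unique diff_divide_distrib)
  qed
  have "((\<lambda>T. ?e T) \<longlongrightarrow> 0) at_top"
  proof (rule tendsto_norm_zero_cancel)
    show "((\<lambda>T. norm (?e T)) \<longlongrightarrow> 0) at_top" using w by simp real_asymp
  qed
  then have "((\<lambda>T. (1 - ?e T) / w) \<longlongrightarrow> (1 - 0) / w) at_top"
    by (intro tendsto_intros w0)
  moreover have "\<forall>\<^sub>F T in at_top. (1 - ?e T) / w = integral {0..T} ?e"
    by (rule eventually_at_top_linorderI[of 0]) (use eq in auto)
  ultimately have "((\<lambda>T. integral {0..T} ?e) \<longlongrightarrow> (1 - 0) / w) at_top"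
    by (rule Lim_transform_eventually)
  from tendsto_unique[OF trivial_limit_at_top_linorder lim this]
  show "(LINT t|lborel. indicat_real {0..} t *\<^sub>R ?e t) = 1 / w"
    by simp
qed

text \<open>Fubini's theorem: for fixed \<open>w\<close> the integral over \<open>t\<close> of
  exp(-(s - c - i w) t) is 1 / (s - c - i w), which converges absolutely as Re s > c.\<close>

lemma laplace_of_line_integral:
  fixes g :: "real \<Rightarrow> complex"
  assumes cont: "continuous_on UNIV g" and bound: "\<And>w. norm (g w) \<le> M * inverse (1 + w\<^sup>2)"
    and s: "Re s > c"
  shows "((\<lambda>t. exp (- s * of_real t) * integral UNIV (\<lambda>w. exp (Complex c w * of_real t) * g w))
    has_integral integral UNIV (\<lambda>w. g w / (s - Complex c w))) {0..}"
proof -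
  have gm[measurable]: "g \<in> borel_measurable borel" using cont by (rule borel_measurable_continuous_onI)
  have gint: "integrable lborel g"
    by (rule Bochner_Integration.integrable_bound[OF
          integrable_mult_right[OF integrable_inverse_1_plus_square_lborel, of M]])
       (use bound in \<open>auto intro: order_trans[OF _ abs_ge_self]\<close>)
  define f where "f = (\<lambda>(t::real, w). (indicat_real {0..} t *\<^sub>R exp (- (s - Complex c w) * of_real t)) * g w)"
  have fm[measurable]: "f \<in> borel_measurable (lborel \<Otimes>\<^sub>M lborel)"
  proof -
    have "continuous_on UNIV (\<lambda>x. exp (- (s - Complex c (snd x)) * of_real (fst x :: real)))"
      by (intro continuous_intros)
    then have [measurable]: "(\<lambda>x. exp (- (s - Complex c (snd x)) * of_real (fst x :: real)))
        \<in> borel_measurable (lborel \<Otimes>\<^sub>M lborel)"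
      by (simp add: lborel_prod borel_measurable_continuous_onI)
    have "(\<lambda>x. (indicat_real {0..} (fst x) *\<^sub>R exp (- (s - Complex c (snd x)) * of_real (fst x))) * g (snd x))
       \<in> borel_measurable (lborel \<Otimes>\<^sub>M lborel)"
      by measurable
    then show ?thesis by (simp add: f_def case_prod_beta')
  qed
  \<comment> \<open>The real part of \<open>Complex c w\<close> does not depend on \<open>w\<close>,
    so the modulus is a function of \<open>t\<close> times a function of \<open>w\<close> and
    absolute integrability splits.\<close>
  have nf: "norm (f (t, w)) = (indicat_real {0..} t * exp (- (Re s - c) * t)) * norm (g w)" for t w
    by (simp add: f_def norm_mult)
  have eint: "integrable lborel (\<lambda>t. indicat_real {0..} t * exp (- (Re s - c) * t))"
    using integrable_norm[OF has_integral_exp_Ici(1)[of "of_real (Re s - c)"]] s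
    by (simp add: indicator_def if_distrib cong: if_cong)
  have fint: "integrable (lborel \<Otimes>\<^sub>M lborel) f"
  proof (rule lborel_pair.Fubini_integrable[OF fm])
    show "integrable lborel (\<lambda>x. LINT y|lborel. norm (f (x, y)))"
      unfolding nf integral_mult_right_zero by (intro integrable_mult_left eint)
    show "AE t in lborel. integrable lborel (\<lambda>w. f (t, w))"
    proof (rule AE_I2)
      fix t
      show "integrable lborel (\<lambda>w. f (t, w))"
        by (rule Bochner_Integration.integrable_bound[OF
              integrable_mult_right[OF integrable_norm[OF gint], of "indicat_real {0..} t * exp (- (Re s - c) * t)"]])
           (auto simp: nf)
    qed
  qed
  have inner1: "(LINT w|lborel. f (t, w)) = (if t \<in> {0..} then
      exp (- s * of_real t) * integral UNIV (\<lambda>w. exp (Complex c w * of_real t) * g w) else 0)" for t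
  proof (cases "t \<ge> 0")
    case True
    have i: "integrable lborel (\<lambda>w. exp (Complex c w * of_real t) * g w)"
    proof (rule Bochner_Integration.integrable_bound[OF
          integrable_mult_right[OF integrable_norm[OF gint], of "exp (c * t)"]])
      have "continuous_on UNIV (\<lambda>w. exp (Complex c w * of_real t) * g w)"
        by (intro continuous_intros cont)
      then show "(\<lambda>w. exp (Complex c w * of_real t) * g w) \<in> borel_measurable lborel"
        by (simp add: borel_measurable_continuous_onI)
    qed (auto simp: norm_mult)
    have "f (t, w) = exp (- s * of_real t) * (exp (Complex c w * of_real t) * g w)" for w
    proof -
      have "exp (- (s - Complex c w) * of_real t) = exp (- s * of_real t) * exp (Complex c w * of_real t)"
        by (simp add: exp_add[symmetric] algebra_simps)
      then show ?thesis using True by (simp add: f_def)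
    qed
    then show ?thesis using True i by (simp add: integral_lborel)
  qed (simp add: f_def)
  have inner2: "(LINT t|lborel. f (t, w)) = g w / (s - Complex c w)" for w
    unfolding f_def prod.case integral_mult_left_zero using has_integral_exp_Ici[of "s - Complex c w"] s by simp
  have "integrable lborel (\<lambda>t. LINT w|lborel. f (t, w))"
    by (rule lborel_pair.integrable_fst'[OF fint])
  then have "((\<lambda>t. LINT w|lborel. f (t, w)) has_integral (LINT t|lborel. LINT w|lborel. f (t, w))) UNIV"
    by (rule has_integral_integral_lborel)
  moreover have "(LINT t|lborel. LINT w|lborel. f (t, w)) = (LINT w|lborel. LINT t|lborel. f (t, w))"
    using lborel_pair.Fubini_integral[of "\<lambda>t w. f (t, w)"] fint by simp
  moreover have "integrable lborel (\<lambda>w. LINT t|lborel. f (t, w))"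
    using lborel_pair.integrable_snd[of "\<lambda>t w. f (t, w)"] fint by simp
  then have "(LINT w|lborel. LINT t|lborel. f (t, w)) = integral UNIV (\<lambda>w. g w / (s - Complex c w))"
    unfolding inner2 by (simp add: integral_lborel)
  ultimately show ?thesis
    unfolding inner1 by (simp only: has_integral_restrict_UNIV)
qed

section \<open>The inverse Laplace transform\<close>

text \<open>The cross terms cancel because the norms come from inner products: for c = exp(i pi / 4)
  the claim is the parallelogram law.\<close>

lemma norm_cscale: "norm (cscale c x) = cmod c * norm (x :: 'a::real_inner complexified)"
proof (rule power2_eq_imp_eq)
  have sq: "(norm y)\<^sup>2 = fst y \<bullet> fst y + snd y \<bullet> snd y" for y :: "'a complexified"
    by (simp add: norm_prod_def dot_square_norm)
  show "(norm (cscale c x))\<^sup>2 = (cmod c * norm x)\<^sup>2"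
    unfolding power_mult_distrib sq cmod_power2
    by (simp add: cscale_def inner_simps inner_commute algebra_simps power2_eq_square)
qed simp_all

lemma bounded_bilinear_cscale:
  "bounded_bilinear (cscale :: complex \<Rightarrow> 'a::real_inner complexified \<Rightarrow> 'a complexified)"
proof
  show "\<exists>K. \<forall>a b. norm (cscale a (b :: 'a complexified)) \<le> norm a * norm b * K"
    by (intro exI[of _ 1]) (simp add: norm_cscale)
qed (simp_all add: cscale_def prod_eq_iff algebra_simps)

lemma cscale_cscale: "cscale a (cscale b x) = cscale (a * b) x"
  by (simp add: cscale_def prod_eq_iff algebra_simps)

lemma cscale_0_right [simp]: "cscale c 0 = 0"
  by (simp add: cscale_def zero_prod_def)

lemmas cscale_add_right = bounded_bilinear.add_right[OF bounded_bilinear_cscale]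
lemmas continuous_on_cscale = bounded_bilinear.continuous_on[OF bounded_bilinear_cscale]
lemmas bounded_linear_cscale_right = bounded_bilinear.bounded_linear_right[OF bounded_bilinear_cscale]

section \<open>Conjugation and real test vectors on the complexified space\<close>

definition cconj :: "'a::real_vector complexified \<Rightarrow> 'a complexified" where
  "cconj x = (fst x, - snd x)"

lemma cconj_cscale: "cconj (cscale c x) = cscale (cnj c) (cconj x)"
  by (simp add: cconj_def cscale_def)

lemma cconj_0 [simp]: "cconj 0 = 0"
  by (simp add: cconj_def zero_prod_def)

lemma norm_cconj [simp]: "norm (cconj x) = norm x"
  by (cases x) (simp add: cconj_def norm_Pair)

lemma bounded_linear_cconj: "bounded_linear (cconj :: 'a::real_normed_vector complexified \<Rightarrow> _)"
  by (rule bounded_linear_intro[where K = 1]) (simp_all add: cconj_def prod_eq_iff norm_prod_def)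

text \<open>The second argument enters complex linearly, the first is only a real vector. Such
  functionals already separate the points of the complexified space, and they reduce vector valued
  holomorphy to the scalar theory.\<close>

definition cinner :: "'a::real_inner \<Rightarrow> 'a complexified \<Rightarrow> complex" where
  "cinner v x = Complex (fst x \<bullet> v) (snd x \<bullet> v)"

lemma cinner_cscale: "cinner v (cscale c x) = c * cinner v x"
  by (simp add: cinner_def cscale_def complex_eq_iff inner_simps)

lemma bounded_linear_cinner: "bounded_linear (cinner v)"
proof -
  have "bounded_linear (\<lambda>x :: 'a complexified. of_real (fst x \<bullet> v) + \<i> * of_real (snd x \<bullet> v))"
    by (intro bounded_linear_add bounded_linear_compose[OF bounded_linear_of_real]
        bounded_linear_compose[OF bounded_linear_mult_right]
        bounded_linear_compose[OF bounded_linear_inner_left bounded_linear_fst]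
        bounded_linear_compose[OF bounded_linear_inner_left bounded_linear_snd])
  then show ?thesis by (simp add: cinner_def[abs_def] Complex_eq)
qed

lemma cinner_eqI: "(\<And>v. cinner v x = cinner v y) \<Longrightarrow> x = y"
  by (intro prod_eqI; subst vector_eq_rdot[symmetric]) (simp_all add: cinner_def)

lemma vector_holomorphic_on_imp_cinner_holomorphic_on:
  assumes "vector_holomorphic_on F S"
  shows "(\<lambda>s. cinner v (F s)) holomorphic_on S"
  unfolding holomorphic_on_def field_differentiable_def
proof
  fix s assume "s \<in> S"
  then obtain d where d: "(F has_derivative (\<lambda>x. cscale x d)) (at s within S)"
    using assms by (auto simp: vector_holomorphic_on_def)
  have "((\<lambda>s. cinner v (F s)) has_derivative (\<lambda>x. cinner v (cscale x d))) (at s within S)"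
    by (rule bounded_linear.has_derivative[OF bounded_linear_cinner d])
  moreover have "(\<lambda>x. cinner v (cscale x d)) = (*) (cinner v d)"
    by (simp add: fun_eq_iff cinner_cscale)
  ultimately show "\<exists>f'. ((\<lambda>s. cinner v (F s)) has_field_derivative f') (at s within S)"
    by (auto simp: has_field_derivative_def)
qed

lemma vector_holomorphic_on_imp_continuous_on:
  "vector_holomorphic_on F S \<Longrightarrow> continuous_on S F"
  unfolding vector_holomorphic_on_def continuous_on_eq_continuous_within
  using has_derivative_continuous by blast

lemma norm_exp_i_diff_le: "cmod (exp (\<i> * of_real x) - exp (\<i> * of_real y)) \<le> \<bar>x - y\<bar>"
proof -
  have "exp (\<i> * of_real x) - exp (\<i> * of_real y) = exp (\<i> * of_real y) * (exp (\<i> * of_real (x - y)) - 1)"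
    by (simp add: exp_add[symmetric] algebra_simps)
  then have "cmod (exp (\<i> * of_real x) - exp (\<i> * of_real y)) = 2 * \<bar>sin ((x - y) / 2)\<bar>"
    by (simp only: norm_mult norm_exp_i_times dist_exp_i_1 mult_1)
  also have "\<dots> \<le> 2 * \<bar>(x - y) / 2\<bar>" by (intro mult_left_mono abs_sin_x_le_abs_x) simp
  finally show ?thesis by simp
qed

text \<open>The function \<open>k\<close> is the Bromwich integral of \<open>F\<close> along Re s =
  a + 1. That it inverts the transform is Fubini's theorem followed by Cauchy's formula.\<close>

lemma inverse_laplace_transform:
  fixes F :: "complex \<Rightarrow> 'a::{real_inner, banach} complexified"
  assumes hol: "vector_holomorphic_on F {s. Re s > a}"
    and bound: "\<And>s. Re s \<ge> a + 1 \<Longrightarrow> norm (F s) \<le> M / cmod (s - of_real a) ^ 4"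
  obtains k where "continuous_on UNIV k"
    "\<And>s. Re s > a + 1 \<Longrightarrow> ((\<lambda>t. cscale (exp (- s * of_real t)) (k t)) has_integral F s) {0..}"
proof -
  define c where "c = a + 1"
  \<comment> \<open>The growing factor exp(c t) is kept outside the integral; the remaining
    integrand is purely oscillatory, so its bound is uniform in \<open>t\<close>.\<close>
  define D where "D = (\<lambda>t w. cscale (exp (\<i> * of_real (w * t))) (F (Complex c w)))"
  define I where "I = (\<lambda>t. integral UNIV (D t))"
  define k where "k = (\<lambda>t. (exp (c * t) / (2 * pi)) *\<^sub>R I t)"
  have contF: "continuous_on UNIV (\<lambda>w. F (Complex c w))"
    by (rule continuous_on_compose2[OF vector_holomorphic_on_imp_continuous_on[OF hol]])
       (auto simp: c_def intro!: continuous_intros)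
  have F1: "norm (F (Complex c w)) \<le> M * (inverse (1 + w\<^sup>2))\<^sup>2"
    and F2: "norm (F (Complex c w)) \<le> M * inverse (1 + w\<^sup>2)" for w
    using vertical_line_bound[OF bound[of "Complex (a + 1) w"]] by (simp_all add: c_def)
  have M0: "M \<ge> 0" using order_trans[OF norm_ge_zero F2[of 0]] by simp
  have majint: "(\<lambda>w::real. M * inverse (1 + w\<^sup>2)) integrable_on UNIV"
    using integrable_on_lborel[OF integrable_inverse_1_plus_square_lborel]
    by (rule integrable_on_mult_right)
  define K where "K = integral UNIV (\<lambda>w::real. M * inverse (1 + w\<^sup>2))"
  have contD: "continuous_on UNIV (D t)" for t
    unfolding D_def by (intro continuous_on_cscale contF continuous_intros)
  have normD: "norm (D t w) \<le> M * inverse (1 + w\<^sup>2)" for t w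
    unfolding D_def norm_cscale norm_exp_i_times using F2[of w] by simp
  have Dint: "D t integrable_on UNIV" for t
    by (rule integrable_on_UNIV_continuous_bound[OF contD majint normD])
  have normI: "norm (I t) \<le> K" for t
    unfolding I_def K_def by (rule integral_norm_bound_integral[OF Dint majint normD])
  \<comment> \<open>Changing \<open>t\<close> costs a factor |w|, and |w| / (1 + w^2)^2 is at most 1
    / (1 + w^2). This is where the decay of order four is spent.\<close>
  have lip: "norm (I t - I t') \<le> \<bar>t - t'\<bar> * K" for t t'
  proof -
    have "norm (integral UNIV (\<lambda>w. D t w - D t' w)) \<le> integral UNIV (\<lambda>w. \<bar>t - t'\<bar> * (M * inverse (1 + w\<^sup>2)))"
    proof (rule integral_norm_bound_integral)
      show "(\<lambda>w. D t w - D t' w) integrable_on UNIV" by (intro Henstock_Kurzweil_Integration.integrable_diff Dint)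
      show "(\<lambda>w. \<bar>t - t'\<bar> * (M * inverse (1 + w\<^sup>2))) integrable_on UNIV"
        by (rule integrable_on_mult_right[OF majint])
      fix w :: real
      have pos: "1 + w\<^sup>2 > 0" by (simp add: add_pos_nonneg)
      have "2 * \<bar>w\<bar> \<le> 1 + w\<^sup>2"
        using zero_le_power2[of "\<bar>w\<bar> - 1"] by (simp add: power2_diff)
      then have "\<bar>w\<bar> \<le> 1 + w\<^sup>2" using abs_ge_zero[of w] by linarith
      have "D t w - D t' w = cscale (exp (\<i> * of_real (w * t)) - exp (\<i> * of_real (w * t'))) (F (Complex c w))"
        unfolding D_def by (rule bounded_bilinear.diff_left[OF bounded_bilinear_cscale, symmetric])
      then have "norm (D t w - D t' w) \<le> \<bar>w * t - w * t'\<bar> * norm (F (Complex c w))"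
        using norm_exp_i_diff_le[of "w * t" "w * t'"] by (simp add: norm_cscale mult_right_mono)
      also have "\<dots> \<le> \<bar>w * t - w * t'\<bar> * (M * (inverse (1 + w\<^sup>2))\<^sup>2)"
        by (intro mult_left_mono F1) simp
      also have "\<dots> = (\<bar>t - t'\<bar> * M * inverse (1 + w\<^sup>2)) * (\<bar>w\<bar> * inverse (1 + w\<^sup>2))"
      proof -
        have "\<bar>w * t - w * t'\<bar> = \<bar>w\<bar> * \<bar>t - t'\<bar>"
          by (simp add: right_diff_distrib[symmetric] abs_mult)
        then show ?thesis by (simp only: power2_eq_square mult_ac)
      qed
      also have "\<dots> \<le> (\<bar>t - t'\<bar> * M * inverse (1 + w\<^sup>2)) * 1"
        using \<open>\<bar>w\<bar> \<le> 1 + w\<^sup>2\<close> pos M0 by (intro mult_left_mono) (auto simp: field_simps)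
      finally show "norm (D t w - D t' w) \<le> \<bar>t - t'\<bar> * (M * inverse (1 + w\<^sup>2))"
        by (simp add: mult_ac)
    qed
    then show ?thesis by (simp add: I_def K_def Henstock_Kurzweil_Integration.integral_diff[OF Dint Dint])
  qed
  have contI: "continuous_on UNIV I"
    unfolding continuous_on_def
  proof
    fix x :: real
    have "((\<lambda>t. \<bar>t - x\<bar> * K) \<longlongrightarrow> 0) (at x within UNIV)"
      by (rule tendsto_eq_intros refl | simp)+
    then have "((\<lambda>t. I t - I x) \<longlongrightarrow> 0) (at x within UNIV)"
      by (rule Lim_null_comparison[rotated]) (simp add: lip)
    then show "(I \<longlongrightarrow> I x) (at x within UNIV)" by (simp add: LIM_zero_iff)
  qed
  have contk: "continuous_on UNIV k"
    unfolding k_def by (intro continuous_intros contI) simp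
  have "((\<lambda>t. cscale (exp (- s * of_real t)) (k t)) has_integral F s) {0..}" if s: "Re s > a + 1" for s
  proof -
    let ?h = "\<lambda>t. cscale (exp (- s * of_real t)) (k t)"
    \<comment> \<open>Since \<open>k\<close> grows at most like exp(c t), the integral converges
      absolutely for Re s > c. Its existence must be known before it can be tested against
      vectors.\<close>
    have hint: "?h integrable_on {0..}"
    proof (rule integrable_on_Ici_continuous_bound)
      show "continuous_on {0..} ?h"
        by (intro continuous_on_cscale continuous_on_subset[OF contk] continuous_intros) simp
      show "(\<lambda>t. K / (2 * pi) * exp (- (Re s - c) * t)) integrable_on {0..}"
        using has_integral_exp_minus_to_infinity[of "Re s - c" 0] s
        by (intro integrable_on_mult_right) (auto simp: c_def integrable_on_def)
      fix t :: real
      have "norm (?h t) = exp (- Re s * t) * (exp (c * t) / (2 * pi) * norm (I t))"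
        by (simp add: norm_cscale k_def)
      also have "\<dots> \<le> exp (- Re s * t) * (exp (c * t) / (2 * pi) * K)"
        by (intro mult_left_mono normI) auto
      also have "\<dots> = K / (2 * pi) * exp (- (Re s - c) * t)"
        by (simp add: exp_add[symmetric] field_simps)
      finally show "norm (?h t) \<le> K / (2 * pi) * exp (- (Re s - c) * t)" .
    qed
    \<comment> \<open>Cauchy's formula and Fubini's theorem are applied to the scalar functions
      \<open>cinner v (F z)\<close> only.\<close>
    have "integral {0..} ?h = F s"
    proof (rule cinner_eqI)
      fix v
      define G where "G = (\<lambda>z. cinner v (F z))"
      obtain N where N: "\<And>x :: 'a complexified. norm (cinner v x) \<le> norm x * N" "N > 0"
        using bounded_linear.pos_bounded[OF bounded_linear_cinner] by blast
      have Gb: "norm (G z) \<le> (M * N) / cmod (z - of_real a) ^ 4" if "Re z \<ge> a + 1" for z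
        using N(1)[of "F z"] mult_right_mono[OF bound[OF that], of N] N(2) by (simp add: G_def)
      have cauchy: "integral UNIV (\<lambda>w. G (Complex c w) / (s - Complex c w)) = 2 * of_real pi * G s"
        unfolding c_def G_def
        by (rule integral_unique[OF half_plane_cauchy[OF vector_holomorphic_on_imp_cinner_holomorphic_on[OF hol]
              Gb[unfolded G_def] s]])
      have "((\<lambda>t. exp (- s * of_real t) * integral UNIV (\<lambda>w. exp (Complex c w * of_real t) * G (Complex c w)))
          has_integral integral UNIV (\<lambda>w. G (Complex c w) / (s - Complex c w))) {0..}"
      proof (rule laplace_of_line_integral)
        show "continuous_on UNIV (\<lambda>w. G (Complex c w))"
          unfolding G_def by (intro bounded_linear.continuous_on[OF bounded_linear_cinner] contF)
        show "norm (G (Complex c w)) \<le> M * N * inverse (1 + w\<^sup>2)" for w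
          using vertical_line_bound(2)[OF Gb[of "Complex (a + 1) w"]] by (simp add: c_def)
        show "c < Re s" using s by (simp add: c_def)
      qed
      then have "((\<lambda>t. exp (- s * of_real t) * integral UNIV (\<lambda>w. exp (Complex c w * of_real t) * G (Complex c w)) / (2 * of_real pi))
          has_integral G s) {0..}"
        unfolding cauchy by (drule_tac has_integral_divide[where c = "2 * of_real pi"]) simp
      moreover have "cinner v (?h t) = exp (- s * of_real t) *
          integral UNIV (\<lambda>w. exp (Complex c w * of_real t) * G (Complex c w)) / (2 * of_real pi)" for t
      proof -
        have "cinner v (I t) = integral UNIV (\<lambda>w. cinner v (D t w))"
          using integral_linear[OF Dint bounded_linear_cinner] by (simp add: I_def o_def)
        then have "of_real (exp (c * t)) * cinner v (I t) = integral UNIV (\<lambda>w. of_real (exp (c * t)) * cinner v (D t w))"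
          by simp
        also have "(\<lambda>w. of_real (exp (c * t)) * cinner v (D t w)) = (\<lambda>w. exp (Complex c w * of_real t) * G (Complex c w))"
        proof
          fix w
          have "exp (Complex c w * of_real t) = of_real (exp (c * t)) * exp (\<i> * of_real (w * t))"
            unfolding exp_of_real[symmetric] exp_add[symmetric] by (simp add: Complex_eq algebra_simps)
          then show "of_real (exp (c * t)) * cinner v (D t w) = exp (Complex c w * of_real t) * G (Complex c w)"
            by (simp add: D_def cinner_cscale G_def)
        qed
        finally have "cinner v (k t) = integral UNIV (\<lambda>w. exp (Complex c w * of_real t) * G (Complex c w)) / (2 * of_real pi)"
          using linear_scale[OF bounded_linear.linear[OF bounded_linear_cinner], of v "exp (c * t) / (2 * pi)" "I t"]
          by (simp add: k_def scaleR_conv_of_real)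
        then show ?thesis by (simp add: cinner_cscale)
      qed
      ultimately have "((\<lambda>t. cinner v (?h t)) has_integral G s) {0..}" by simp
      moreover have "((\<lambda>t. cinner v (?h t)) has_integral cinner v (integral {0..} ?h)) {0..}"
        using has_integral_linear[OF integrable_integral[OF hint] bounded_linear_cinner] by (simp add: o_def)
      ultimately show "cinner v (integral {0..} ?h) = cinner v (F s)"
        unfolding G_def by (rule has_integral_unique[OF _ _, rotated])
    qed
    then show ?thesis using integrable_integral[OF hint] by simp
  qed
  with contk show ?thesis by (rule that)
qed

section \<open>Laplace transforms of derivatives and delays\<close>

text \<open>Convergence of an improper integral does not make the integrand tend to 0, but any limit
  it has must be 0: the integrals over [T, T+1] tend both to that limit and, by Cauchy's criterion,
  to 0.\<close>

lemma has_integral_Ici_limit_eq_0: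
  fixes f :: "real \<Rightarrow> 'a::banach"
  assumes int: "(f has_integral I) {0..}" and lim: "(f \<longlongrightarrow> L) at_top"
  shows "L = 0"
proof -
  have fint: "f integrable_on {a..b}" if "a \<ge> 0" for a b
    using int that by (intro integrable_on_subinterval[of f "{0..}"]) auto
  have P: "((\<lambda>T. integral {0..T} f) \<longlongrightarrow> I) at_top"
    by (rule has_integral_Ici_tendsto[OF int])
  have "filterlim (\<lambda>T::real. T + 1) at_top at_top" by real_asymp
  then have "((\<lambda>T. integral {0..T+1} f) \<longlongrightarrow> I) at_top"
    by (rule filterlim_compose[OF P])
  then have diff: "((\<lambda>T. integral {0..T+1} f - integral {0..T} f) \<longlongrightarrow> I - I) at_top"
    by (intro tendsto_diff P)
  have "((\<lambda>T. integral {0..T+1} f - integral {0..T} f) \<longlongrightarrow> L) at_top"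
  proof (rule tendstoI)
    fix e :: real assume "e > 0"
    then have "\<forall>\<^sub>F t in at_top. dist (f t) L < e / 2"
      by (intro tendstoD[OF lim]) simp
    then obtain T0 where T0: "\<And>t. t \<ge> T0 \<Longrightarrow> dist (f t) L < e / 2"
      by (auto simp: eventually_at_top_linorder)
    show "\<forall>\<^sub>F T in at_top. dist (integral {0..T+1} f - integral {0..T} f) L < e"
    proof (rule eventually_at_top_linorderI)
      fix T assume T: "T \<ge> max 0 T0"
      have "((\<lambda>t. f t - L) has_integral (integral {T..T+1} f - ((T + 1) - T) *\<^sub>R L)) (cbox T (T+1))"
        using T has_integral_const_real[of L T "T+1"]
        by (intro has_integral_diff) (auto intro: integrable_integral fint)
      then have "norm (integral {T..T+1} f - ((T + 1) - T) *\<^sub>R L) \<le> e / 2 * Henstock_Kurzweil_Integration.content (cbox T (T+1))"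
        by (rule has_integral_bound[rotated])
           (use T T0 \<open>e > 0\<close> in \<open>auto simp: dist_norm intro!: less_imp_le\<close>)
      moreover have "integral {0..T+1} f - integral {0..T} f = integral {T..T+1} f"
        using Henstock_Kurzweil_Integration.integral_combine[of 0 T "T+1" f] T fint[of 0 "T+1"]
        by (simp add: algebra_simps)
      ultimately show "dist (integral {0..T+1} f - integral {0..T} f) L < e"
        using \<open>e > 0\<close> by (simp add: dist_norm)
    qed
  qed
  from tendsto_unique[OF trivial_limit_at_top_linorder this diff] show ?thesis by simp
qed

lemma has_integral_UNIV_shift:
  fixes f :: "real \<Rightarrow> 'a::banach"
  assumes "(f has_integral I) UNIV"
  shows "((\<lambda>x. f (x - h)) has_integral I) UNIV"
proof -
  have f: "\<And>a b. f integrable_on {a..b}"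
    "\<And>e. e > 0 \<Longrightarrow> \<exists>B>0. \<forall>a b. ball 0 B \<subseteq> {a..b} \<longrightarrow> norm (integral {a..b} f - I) < e"
    using assms unfolding has_integral_alt' by auto
  have shift: "((\<lambda>x. f (x - h)) has_integral integral {a - h..b - h} f) {a..b}" for a b
    using has_integral_shift_real_ivl[OF integrable_integral[OF f(1)[of "a - h" "b - h"]], of "- h"] by simp
  have "\<exists>B>0. \<forall>a b. ball 0 B \<subseteq> {a..b} \<longrightarrow> norm (integral {a..b} (\<lambda>x. f (x - h)) - I) < e" if e: "e > 0" for e
  proof -
    obtain B where B: "B > 0" "\<And>a b. ball 0 B \<subseteq> {a..b} \<Longrightarrow> norm (integral {a..b} f - I) < e"
      using f(2)[OF e] by blast
    \<comment> \<open>The radius is enlarged by |h| so that the translated interval still contains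
      the ball of radius \<open>B\<close>.\<close>
    have "norm (integral {a..b} (\<lambda>x. f (x - h)) - I) < e" if ab: "ball 0 (B + \<bar>h\<bar>) \<subseteq> {a..b}" for a b
    proof -
      have sub: "ball (0::real) B \<subseteq> {a - h..b - h}"
      proof
        fix x :: real assume x: "x \<in> ball 0 B"
        have "x + h \<in> ball 0 (B + \<bar>h\<bar>)" using x by (auto simp: dist_real_def)
        then show "x \<in> {a - h..b - h}" using ab by auto
      qed
      show ?thesis using B(2)[OF sub] unfolding integral_unique[OF shift[of a b]] .
    qed
    then show ?thesis using B(1) by (intro exI[of _ "B + \<bar>h\<bar>"]) auto
  qed
  then show ?thesis
    unfolding has_integral_alt' using has_integral_integrable[OF shift] by auto
qed

text \<open>No growth bound on \<open>v\<close> is assumed. The boundary term exp(-s T) v(T) is the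
  integral of its own derivative, hence has the limit V' - s V because both transforms converge. It
  is also the integrand of the convergent integral \<open>V\<close>, so this limit is 0.\<close>

lemma laplace_derivative:
  fixes v :: "real \<Rightarrow> 'a::{real_inner, banach}"
  assumes deriv: "\<And>t. t \<ge> 0 \<Longrightarrow> (v has_vector_derivative v' t) (at t within {0..})"
    and v0: "v 0 = 0"
    and V: "((\<lambda>t. cscale (exp (- s * of_real t)) (v t, 0)) has_integral V) {0..}"
    and V': "((\<lambda>t. cscale (exp (- s * of_real t)) (v' t, 0)) has_integral V') {0..}"
  shows "V' = cscale s V"
proof -
  let ?p = "\<lambda>t. cscale (exp (- s * of_real t)) (v t, 0)"
  let ?p' = "\<lambda>t. cscale (exp (- s * of_real t)) (v' t, 0)"
  have d: "(?p has_vector_derivative (?p' t + cscale (- s) (?p t))) (at t within {0..T})" if t: "t \<in> {0..T}" for t T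
  proof -
    have "((\<lambda>z. exp (- s * z)) has_field_derivative - s * exp (- s * of_real t)) (at (of_real t))"
      by (auto intro!: derivative_eq_intros)
    then have e: "((\<lambda>t. exp (- s * of_real t)) has_vector_derivative - s * exp (- s * of_real t)) (at t within {0..})"
      by (rule has_vector_derivative_real_field)
    have "((\<lambda>t. (v t, 0 :: 'a)) has_vector_derivative (v' t, 0)) (at t within {0..})"
      using t by (intro bounded_linear.has_vector_derivative[OF bounded_linear_Pair[OF bounded_linear_ident bounded_linear_zero]] deriv) auto
    from bounded_bilinear.has_vector_derivative[OF bounded_bilinear_cscale e this]
    have "(?p has_vector_derivative (?p' t + cscale (- s) (?p t))) (at t within {0..})"
      by (simp add: cscale_cscale)
    then show ?thesis by (rule has_vector_derivative_within_subset) auto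
  qed
  have sV: "((\<lambda>t. cscale (- s) (?p t)) has_integral cscale (- s) V) {0..}"
    using has_integral_linear[OF V bounded_linear_cscale_right] by (simp add: o_def)
  have int: "((\<lambda>t. ?p' t + cscale (- s) (?p t)) has_integral (V' + cscale (- s) V)) {0..}"
    by (rule has_integral_add[OF V' sV])
  have "integral {0..T} (\<lambda>t. ?p' t + cscale (- s) (?p t)) = ?p T" if "T \<ge> 0" for T
    using fundamental_theorem_of_calculus[OF that d] v0
    by (simp add: integral_unique cscale_def zero_prod_def)
  then have "\<forall>\<^sub>F T in at_top. integral {0..T} (\<lambda>t. ?p' t + cscale (- s) (?p t)) = ?p T"
    by (intro eventually_at_top_linorderI[of 0])
  from Lim_transform_eventually[OF has_integral_Ici_tendsto[OF int] this]
  have "V' + cscale (- s) V = 0"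
    by (rule has_integral_Ici_limit_eq_0[OF V])
  moreover have "cscale (- s) V = - cscale s V"
    by (rule bounded_bilinear.minus_left[OF bounded_bilinear_cscale])
  ultimately show ?thesis by simp
qed

lemma laplace_delay:
  fixes f :: "real \<Rightarrow> 'a::{real_inner, banach}"
  assumes h: "h \<ge> 0"
    and V: "((\<lambda>t. cscale (exp (- s * of_real t)) (f t, 0)) has_integral V) {0..}"
    and zero: "\<And>t. 0 \<le> t \<Longrightarrow> t < h \<Longrightarrow> f (t - h) = 0"
  shows "((\<lambda>t. cscale (exp (- s * of_real t)) (f (t - h), 0)) has_integral cscale (exp (- s * of_real h)) V) {0..}"
proof -
  let ?g = "\<lambda>t. if t \<in> {0..} then cscale (exp (- s * of_real t)) (f t, 0) else 0"
  have "(?g has_integral V) UNIV" using V by (simp only: has_integral_restrict_UNIV)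
  from has_integral_linear[OF has_integral_UNIV_shift[OF this, of h] bounded_linear_cscale_right]
  have "((\<lambda>t. cscale (exp (- s * of_real h)) (?g (t - h))) has_integral cscale (exp (- s * of_real h)) V) UNIV"
    by (simp only: o_def)
  moreover have "cscale (exp (- s * of_real h)) (?g (t - h)) =
      (if t \<in> {0..} then cscale (exp (- s * of_real t)) (f (t - h), 0) else 0)" for t
  proof (cases "t \<ge> h")
    case True
    have "exp (- s * of_real t) = exp (- s * of_real h) * exp (- s * of_real (t - h))"
      by (simp add: exp_add[symmetric] algebra_simps)
    then show ?thesis using True h by (simp add: cscale_cscale)
  next
    case False
    then show ?thesis using zero[of t] by (auto simp: cscale_def zero_prod_def)
  qed
  ultimately show ?thesis by (simp only: has_integral_restrict_UNIV)
qed

section \<open>Resolvent and transfer function\<close>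

lemma linear_operator_onD:
  assumes "linear_operator_on D A"
  shows "subspace D" "x \<in> D \<Longrightarrow> y \<in> D \<Longrightarrow> A (x + y) = A x + A y" "x \<in> D \<Longrightarrow> A (c *\<^sub>R x) = c *\<^sub>R A x"
    "x \<in> D \<Longrightarrow> A (- x) = - A x" "x \<in> D \<Longrightarrow> y \<in> D \<Longrightarrow> A (x - y) = A x - A y" "A 0 = 0"
proof -
  show sub: "subspace D" and add: "x \<in> D \<Longrightarrow> y \<in> D \<Longrightarrow> A (x + y) = A x + A y"
    and scale: "x \<in> D \<Longrightarrow> A (c *\<^sub>R x) = c *\<^sub>R A x" for x y c
    using assms by (auto simp: linear_operator_on_def)
  show minus: "x \<in> D \<Longrightarrow> A (- x) = - A x" for x
    using scale[of x "-1"] by simp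
  show "x \<in> D \<Longrightarrow> y \<in> D \<Longrightarrow> A (x - y) = A x - A y"
    using add[of x "- y"] minus[of y] subspace_neg[OF sub] by simp
  show "A 0 = 0"
    using scale[of 0 0] subspace_0[OF sub] by simp
qed

lemma bounded_linear_imp_linear_operator_on: "bounded_linear A \<Longrightarrow> linear_operator_on UNIV A"
  by (simp add: linear_operator_on_def linear_simps)

lemma subspace_cscale:
  assumes "subspace D" "x \<in> D \<times> D"
  shows "cscale c x \<in> D \<times> D"
  using assms by (auto simp: cscale_def intro!: subspace_add subspace_diff subspace_scale)

lemma subspace_cconj: "subspace D \<Longrightarrow> x \<in> D \<times> D \<Longrightarrow> cconj x \<in> D \<times> D"
  by (auto simp: cconj_def intro!: subspace_neg)

lemma subspace_complexified_add: "subspace D \<Longrightarrow> x \<in> D \<times> D \<Longrightarrow> y \<in> D \<times> D \<Longrightarrow> x + y \<in> D \<times> D"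
  by (auto intro!: subspace_add simp: mem_Times_iff)

lemma
  assumes A: "linear_operator_on D A" and x: "x \<in> D \<times> D"
  shows cext_cscale: "cext A (cscale c x) = cscale c (cext A x)"
    and cext_cconj: "cext A (cconj x) = cconj (cext A x)"
    and cext_add: "y \<in> D \<times> D \<Longrightarrow> cext A (x + y) = cext A x + cext A y"
  using x linear_operator_onD[OF A] subspace_scale[OF linear_operator_onD(1)[OF A]]
  by (auto simp: cext_def cscale_def cconj_def)

section \<open>Block operators, the inverse pencil and its symmetry under conjugation\<close>

locale linear_delay_system =
  fixes \<Sigma> :: "('u::{real_inner, banach}, 'h::{real_inner, banach}, 'y::{real_inner, banach}) delay_system"
  assumes linE: "linear_operator_on (domE \<Sigma>) (opE \<Sigma>)"
    and linA0: "linear_operator_on (domA0 \<Sigma>) (opA0 \<Sigma>)"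
    and linA1: "linear_operator_on (domA1 \<Sigma>) (opA1 \<Sigma>)"
    and blB: "bounded_linear (opB \<Sigma>)" and blC: "bounded_linear (opC \<Sigma>)"
begin

lemma subspace_state_dom: "subspace (state_dom \<Sigma>)"
  unfolding state_dom_def
  by (intro subspace_Times subspace_inter linear_operator_onD(1)[OF linE]
      linear_operator_onD(1)[OF linA0] linear_operator_onD(1)[OF linA1])

lemma linear_blockE: "linear_operator_on (state_dom \<Sigma>) (blockE \<Sigma>)"
  and linear_blockA0: "linear_operator_on (state_dom \<Sigma>) (blockA0 \<Sigma>)"
  and linear_blockA1: "linear_operator_on (state_dom \<Sigma>) (blockA1 \<Sigma>)"
  unfolding linear_operator_on_def
  using subspace_state_dom linear_operator_onD[OF linE] linear_operator_onD[OF linA0] linear_operator_onD[OF linA1]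
  by (auto simp: state_dom_def blockE_def blockA0_def blockA1_def algebra_simps)

lemma bounded_linear_blockB: "bounded_linear (blockB \<Sigma>)"
  unfolding blockB_def by (intro bounded_linear_Pair bounded_linear_zero blB)

lemma bounded_linear_blockC: "bounded_linear (blockC \<Sigma>)"
  unfolding blockC_def
  by (intro bounded_linear_Pair bounded_linear_zero bounded_linear_compose[OF blC] bounded_linear_fst)

lemmas linear_blockB = bounded_linear_imp_linear_operator_on[OF bounded_linear_blockB]
lemmas linear_blockC = bounded_linear_imp_linear_operator_on[OF bounded_linear_blockC]

text \<open>The blocks are real operators, so conjugation passes through them and acts on the two
  scalars alone; hence both \<open>s\<close> and \<open>q\<close> are conjugated.\<close>

lemma
  assumes x: "x \<in> state_dom \<Sigma> \<times> state_dom \<Sigma>"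
  shows pencil_cscale: "pencil \<Sigma> s q (cscale c x) = cscale c (pencil \<Sigma> s q x)"
    and pencil_cconj: "pencil \<Sigma> (cnj s) (cnj q) (cconj x) = cconj (pencil \<Sigma> s q x)"
    and pencil_add: "y \<in> state_dom \<Sigma> \<times> state_dom \<Sigma> \<Longrightarrow>
      pencil \<Sigma> s q (x + y) = pencil \<Sigma> s q x + pencil \<Sigma> s q y"
  unfolding pencil_def cext_cscale[OF linear_blockE x] cext_cscale[OF linear_blockA0 x] cext_cscale[OF linear_blockA1 x]
    cext_cconj[OF linear_blockE x] cext_cconj[OF linear_blockA0 x] cext_cconj[OF linear_blockA1 x]
    cconj_cscale[symmetric] bounded_bilinear.diff_right[OF bounded_bilinear_cscale] cscale_cscale
    linear_diff[OF bounded_linear.linear[OF bounded_linear_cconj]]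
  by (simp_all add: mult.commute cext_add[OF linear_blockE x] cext_add[OF linear_blockA0 x]
      cext_add[OF linear_blockA1 x] cscale_add_right)

definition resolvent :: "complex \<Rightarrow> ('h \<times> 'h) complexified \<Rightarrow> ('h \<times> 'h) complexified" where
  "resolvent s = the_inv_into (state_dom \<Sigma> \<times> state_dom \<Sigma>) (pencil \<Sigma> s (delay_factor \<Sigma> s))"

definition regular :: "complex \<Rightarrow> bool" where
  "regular s \<longleftrightarrow> invertible_operator (state_dom \<Sigma> \<times> state_dom \<Sigma>) (pencil \<Sigma> s (delay_factor \<Sigma> s))"

definition transfer :: "complex \<Rightarrow> 'u complexified \<Rightarrow> ('y \<times> 'y) complexified" where
  "transfer s x = transfer_function \<Sigma> s (delay_factor \<Sigma> s) x"

lemma transfer_eq: "transfer s x = cext (blockC \<Sigma>) (resolvent s (cext (blockB \<Sigma>) x))"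
  by (simp add: transfer_def transfer_function_def resolvent_def)

lemma
  assumes "regular s"
  shows resolvent_mem: "resolvent s y \<in> state_dom \<Sigma> \<times> state_dom \<Sigma>"
    and pencil_resolvent: "pencil \<Sigma> s (delay_factor \<Sigma> s) (resolvent s y) = y"
    and resolvent_eqI: "x \<in> state_dom \<Sigma> \<times> state_dom \<Sigma> \<Longrightarrow>
      pencil \<Sigma> s (delay_factor \<Sigma> s) x = y \<Longrightarrow> resolvent s y = x"
proof -
  have bij: "bij_betw (pencil \<Sigma> s (delay_factor \<Sigma> s)) (state_dom \<Sigma> \<times> state_dom \<Sigma>) UNIV"
    using assms by (simp add: regular_def invertible_operator_def)
  show "resolvent s y \<in> state_dom \<Sigma> \<times> state_dom \<Sigma>"
    unfolding resolvent_def using bij_betw_the_inv_into[OF bij] by (rule bij_betwE[THEN bspec]) simp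
  show "pencil \<Sigma> s (delay_factor \<Sigma> s) (resolvent s y) = y"
    unfolding resolvent_def by (rule f_the_inv_into_f_bij_betw[OF bij]) simp
  show "x \<in> state_dom \<Sigma> \<times> state_dom \<Sigma> \<Longrightarrow> pencil \<Sigma> s (delay_factor \<Sigma> s) x = y \<Longrightarrow> resolvent s y = x"
    unfolding resolvent_def using the_inv_into_f_f[OF bij_betw_imp_inj_on[OF bij]] by blast
qed

lemma resolvent_add: "regular s \<Longrightarrow> resolvent s (x + y) = resolvent s x + resolvent s y"
  by (rule resolvent_eqI)
     (simp_all add: pencil_add resolvent_mem pencil_resolvent
       subspace_complexified_add[OF subspace_state_dom] del: mem_Sigma_iff)

lemma resolvent_cscale: "regular s \<Longrightarrow> resolvent s (cscale c x) = cscale c (resolvent s x)"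
  by (rule resolvent_eqI)
     (simp_all add: pencil_cscale resolvent_mem pencil_resolvent
       subspace_cscale[OF subspace_state_dom] del: mem_Sigma_iff)

lemma delay_factor_cnj: "delay_factor \<Sigma> (cnj s) = cnj (delay_factor \<Sigma> s)"
  by (simp add: delay_factor_def exp_cnj)

lemma resolvent_cconj:
  assumes "regular s" "regular (cnj s)"
  shows "resolvent (cnj s) (cconj x) = cconj (resolvent s x)"
  using assms by (intro resolvent_eqI)
     (simp_all add: delay_factor_cnj pencil_cconj resolvent_mem pencil_resolvent
       subspace_cconj[OF subspace_state_dom] del: mem_Sigma_iff)

lemma bounded_linear_resolvent:
  assumes "regular s"
  shows "bounded_linear (resolvent s)"
proof -
  obtain K where K: "\<And>y. norm (resolvent s y) \<le> K * norm y"
    using assms by (auto simp: regular_def invertible_operator_def resolvent_def)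
  have scale: "r *\<^sub>R x = cscale (of_real r) x" for r and x :: "('h \<times> 'h) complexified"
    by (simp add: cscale_def prod_eq_iff)
  show ?thesis
    by (rule bounded_linear_intro[where K = K])
       (use K in \<open>simp_all add: resolvent_add[OF assms] scale resolvent_cscale[OF assms] mult.commute\<close>)
qed

lemma transfer_add: "regular s \<Longrightarrow> transfer s (x + y) = transfer s x + transfer s y"
  by (simp add: transfer_eq cext_add[OF linear_blockB] cext_add[OF linear_blockC] resolvent_add)

lemma transfer_cscale: "regular s \<Longrightarrow> transfer s (cscale c x) = cscale c (transfer s x)"
  by (simp add: transfer_eq cext_cscale[OF linear_blockB] cext_cscale[OF linear_blockC] resolvent_cscale)

lemma transfer_cconj:
  "regular s \<Longrightarrow> regular (cnj s) \<Longrightarrow> transfer (cnj s) (cconj x) = cconj (transfer s x)"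
  by (simp add: transfer_eq cext_cconj[OF linear_blockB] cext_cconj[OF linear_blockC] resolvent_cconj)

end

section \<open>Strictly proper functions\<close>

lemma eventually_right_half_planes:
  "(\<forall>\<^sub>F s in right_half_planes. P s) \<longleftrightarrow> (\<exists>b. \<forall>s. Re s > b \<longrightarrow> P s)"
  by (auto simp: right_half_planes_def eventually_filtercomap eventually_at_top_dense)

lemma eventually_right_half_planes_cnj:
  "(\<forall>\<^sub>F s in right_half_planes. P s) \<Longrightarrow> (\<forall>\<^sub>F s in right_half_planes. P (cnj s))"
  unfolding eventually_right_half_planes
proof (elim exE)
  fix b assume "\<forall>s. Re s > b \<longrightarrow> P s"
  then have "\<forall>s. Re s > b \<longrightarrow> P (cnj s)" by simp
  then show "\<exists>b. \<forall>s. Re s > b \<longrightarrow> P (cnj s)" ..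
qed

definition laplace_integrand :: "complex \<Rightarrow> (real \<Rightarrow> 'a::real_vector) \<Rightarrow> real \<Rightarrow> 'a complexified" where
  "laplace_integrand s f = (\<lambda>t. cscale (exp (- s * of_real t)) (f t, 0))"

lemma has_laplace_iff:
  "has_laplace f F \<longleftrightarrow> (\<forall>\<^sub>F s in right_half_planes. (laplace_integrand s f has_integral F s) {0..})"
  by (simp add: has_laplace_def laplace_integrand_def)

lemma cext_laplace_integrand:
  assumes A: "linear_operator_on D A" and f: "f t \<in> D"
  shows "cext A (laplace_integrand s f t) = laplace_integrand s (\<lambda>t. A (f t)) t"
proof -
  have "(f t, 0) \<in> D \<times> D" using f subspace_0[OF linear_operator_onD(1)[OF A]] by simp
  then show ?thesis
    unfolding laplace_integrand_def cext_cscale[OF A \<open>(f t, 0) \<in> D \<times> D\<close>]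
    by (simp add: cext_def linear_operator_onD(6)[OF A])
qed

lemma null_signal_imp_laplace_zero:
  fixes y :: "real \<Rightarrow> 'a::{real_inner, banach}"
  assumes "null_signal y" "has_laplace y Y"
  shows "\<forall>\<^sub>F s in right_half_planes. Y s = 0"
  using assms(2) unfolding has_laplace_def
proof eventually_elim
  case (elim s)
  have "((\<lambda>t. cscale (exp (- s * of_real t)) (y t, 0)) has_integral 0) {0..}"
    by (rule has_integral_negligible[OF assms(1)[unfolded null_signal_def]])
       (auto simp: cscale_def zero_prod_def)
  with elim show ?case by (rule has_integral_unique)
qed

section \<open>Calculus of vector valued holomorphic functions\<close>

lemma vector_holomorphic_on_cscale:
  fixes F :: "complex \<Rightarrow> 'a::real_inner complexified"
  assumes g: "g holomorphic_on S" and F: "vector_holomorphic_on F S"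
  shows "vector_holomorphic_on (\<lambda>s. cscale (g s) (F s)) S"
  unfolding vector_holomorphic_on_def
proof
  fix s assume s: "s \<in> S"
  obtain d where d: "(F has_derivative (\<lambda>x. cscale x d)) (at s within S)"
    using F s by (auto simp: vector_holomorphic_on_def)
  obtain g' where g': "(g has_derivative (*) g') (at s within S)"
    using g s by (auto simp: holomorphic_on_def field_differentiable_def has_field_derivative_def)
  have "((\<lambda>s. cscale (g s) (F s)) has_derivative
      (\<lambda>h. cscale (g s) (cscale h d) + cscale (g' * h) (F s))) (at s within S)"
    by (rule bounded_bilinear.FDERIV[OF bounded_bilinear_cscale g' d])
  moreover have "cscale (g s) (cscale h d) + cscale (g' * h) (F s) = cscale h (cscale (g s) d + cscale g' (F s))" for h
    by (simp add: cscale_add_right cscale_cscale mult.commute)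
  ultimately have "((\<lambda>s. cscale (g s) (F s)) has_derivative
      (\<lambda>h. cscale h (cscale (g s) d + cscale g' (F s)))) (at s within S)"
    by simp
  then show "\<exists>d. ((\<lambda>s. cscale (g s) (F s)) has_derivative (\<lambda>x. cscale x d)) (at s within S)" ..
qed

lemma vector_holomorphic_on_add:
  fixes F :: "complex \<Rightarrow> 'a::real_inner complexified"
  assumes "vector_holomorphic_on F S" "vector_holomorphic_on G S"
  shows "vector_holomorphic_on (\<lambda>s. F s + G s) S"
  unfolding vector_holomorphic_on_def
proof
  fix s assume s: "s \<in> S"
  obtain d e where "(F has_derivative (\<lambda>x. cscale x d)) (at s within S)"
      "(G has_derivative (\<lambda>x. cscale x e)) (at s within S)"
    using assms s unfolding vector_holomorphic_on_def by blast
  then have "((\<lambda>s. F s + G s) has_derivative (\<lambda>x. cscale x d + cscale x e)) (at s within S)"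
    by (rule has_derivative_add)
  then show "\<exists>d. ((\<lambda>s. F s + G s) has_derivative (\<lambda>x. cscale x d)) (at s within S)"
    unfolding cscale_add_right[symmetric] ..
qed

text \<open>Schwarz reflection: conjugating the variable makes the derivative antilinear, and
  conjugating the value makes it complex linear again.\<close>

lemma vector_holomorphic_on_reflect:
  assumes F: "vector_holomorphic_on F S" and S: "cnj ` S = S"
  shows "vector_holomorphic_on (\<lambda>s. cconj (F (cnj s))) S"
  unfolding vector_holomorphic_on_def
proof
  fix s assume s: "s \<in> S"
  then have "cnj s \<in> S" using S by blast
  then obtain d where "(F has_derivative (\<lambda>x. cscale x d)) (at (cnj s) within cnj ` S)"
    using F unfolding vector_holomorphic_on_def S by blast
  with bounded_linear_imp_has_derivative[OF bounded_linear_cnj]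
  have "((\<lambda>s. F (cnj s)) has_derivative (\<lambda>x. cscale (cnj x) d)) (at s within S)"
    by (rule has_derivative_in_compose)
  from bounded_linear.has_derivative[OF bounded_linear_cconj this]
  have "((\<lambda>s. cconj (F (cnj s))) has_derivative (\<lambda>x. cscale x (cconj d))) (at s within S)"
    by (simp add: cconj_cscale)
  then show "\<exists>d. ((\<lambda>s. cconj (F (cnj s))) has_derivative (\<lambda>x. cscale x d)) (at s within S)" ..
qed

lemma vector_holomorphic_on_subset:
  "vector_holomorphic_on F S \<Longrightarrow> T \<subseteq> S \<Longrightarrow> vector_holomorphic_on F T"
  unfolding vector_holomorphic_on_def by (meson has_derivative_subset subset_iff)

lemma strictly_proper_cscale:
  fixes U :: "complex \<Rightarrow> 'a::real_inner complexified"
  assumes "U \<in> strictly_proper"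
  shows "(\<lambda>s. cscale c (U s)) \<in> strictly_proper"
proof -
  obtain a where a: "vector_holomorphic_on U {s. Re s > a}"
      "(U \<longlongrightarrow> 0) (inf at_infinity (principal {s. Re s > a}))"
    using assms by (auto simp: strictly_proper_def)
  have "((\<lambda>s. cscale c (U s)) \<longlongrightarrow> cscale c 0) (inf at_infinity (principal {s. Re s > a}))"
    by (rule bounded_linear.tendsto[OF bounded_linear_cscale_right a(2)])
  then show ?thesis
    unfolding strictly_proper_def
    using vector_holomorphic_on_cscale[OF holomorphic_on_const a(1), of c] by auto
qed

text \<open>Nothing controls \<open>U\<close> near the boundary line Re s = a, so the half-plane is
  shrunk by 1. There the limit bounds \<open>U\<close> for large s, and what remains is
  compact.\<close>

lemma strictly_proper_bounded:
  assumes hol: "vector_holomorphic_on U {s. Re s > a}"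
    and lim: "(U \<longlongrightarrow> 0) (inf at_infinity (principal {s. Re s > a}))"
  obtains M where "\<And>s. Re s \<ge> a + 1 \<Longrightarrow> norm (U s) \<le> M"
proof -
  have "\<forall>\<^sub>F s in inf at_infinity (principal {s. Re s > a}). norm (U s) < 1"
    using tendstoD[OF lim, of 1] by simp
  then obtain b where b: "\<And>s. norm s \<ge> b \<Longrightarrow> Re s > a \<Longrightarrow> norm (U s) < 1"
    by (auto simp: eventually_inf_principal eventually_at_infinity)
  let ?K = "cball 0 b \<inter> {s. Re s \<ge> a + 1}"
  have "compact ?K" by (intro compact_Int_closed compact_cball closed_halfspace_Re_ge)
  moreover have "continuous_on ?K U"
    by (rule continuous_on_subset[OF vector_holomorphic_on_imp_continuous_on[OF hol]]) auto
  ultimately have "bounded (U ` ?K)" by (intro compact_imp_bounded compact_continuous_image)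
  then obtain K where K: "\<And>s. s \<in> ?K \<Longrightarrow> norm (U s) \<le> K"
    unfolding bounded_iff by blast
  have "norm (U s) \<le> max 1 K" if "Re s \<ge> a + 1" for s
    using b[of s] K[of s] that by (cases "norm s \<ge> b") auto
  then show ?thesis by (rule that)
qed

text \<open>If \<open>F\<close> is the transform of k, this is the transform of the real part of k.
  The comparison with \<open>U\<close> is required only on Re s > b, because a quotient such as U(s)
  / (s - a)^4 exceeds \<open>U\<close> in norm near s = a.\<close>

lemma strictly_proper_real_part:
  fixes F U :: "complex \<Rightarrow> 'a::real_inner complexified"
  assumes hol: "vector_holomorphic_on F {s. Re s > a}"
    and lim: "(U \<longlongrightarrow> 0) (inf at_infinity (principal {s. Re s > a}))"
    and le: "\<And>s. Re s > b \<Longrightarrow> norm (F s) \<le> norm (U s)" and ab: "a \<le> b"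
  shows "(\<lambda>s. cscale (1 / 2) (F s + cconj (F (cnj s)))) \<in> strictly_proper"
proof -
  let ?S = "{s. Re s > b}"
  let ?A = "inf at_infinity (principal ?S)"
  have holF: "vector_holomorphic_on F ?S"
    by (rule vector_holomorphic_on_subset[OF hol]) (use ab in auto)
  have S: "cnj ` ?S = ?S"
  proof (intro equalityI subsetI)
    fix s assume "s \<in> ?S"
    then show "s \<in> cnj ` ?S" using imageI[of "cnj s" ?S cnj] by simp
  qed auto
  have limU: "(U \<longlongrightarrow> 0) ?A"
    by (rule tendsto_mono[OF inf_mono lim]) (use ab in auto)
  \<comment> \<open>Conjugation preserves both the modulus and the half-plane.\<close>
  have "filterlim cnj ?A ?A"
    unfolding filterlim_iff eventually_inf_principal eventually_at_infinity
  proof (intro allI impI, elim exE)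
    fix P B assume "\<forall>s. B \<le> norm s \<longrightarrow> s \<in> ?S \<longrightarrow> P s"
    then have "\<forall>s. B \<le> norm s \<longrightarrow> s \<in> ?S \<longrightarrow> P (cnj s)" by simp
    then show "\<exists>B. \<forall>s. B \<le> norm s \<longrightarrow> s \<in> ?S \<longrightarrow> P (cnj s)" ..
  qed
  then have limU': "((\<lambda>s. U (cnj s)) \<longlongrightarrow> 0) ?A"
    by (rule filterlim_compose[OF limU])
  have "((\<lambda>s. cscale (1 / 2) (F s + cconj (F (cnj s)))) \<longlongrightarrow> 0) ?A"
  proof (rule Lim_null_comparison)
    have "norm (cscale (1 / 2) (F s + cconj (F (cnj s)))) \<le> norm (U s) + norm (U (cnj s))" if "s \<in> ?S" for s
    proof -
      have "norm (cscale (1 / 2) (F s + cconj (F (cnj s)))) \<le> norm (F s) + norm (cconj (F (cnj s)))"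
      proof -
        have half: "cmod (1 / 2) = 1 / 2" by simp
        show ?thesis
          unfolding norm_cscale half
          using norm_triangle_ineq[of "F s" "cconj (F (cnj s))"]
            norm_ge_zero[of "F s"] norm_ge_zero[of "cconj (F (cnj s))"] by linarith
      qed
      also have "\<dots> \<le> norm (U s) + norm (U (cnj s))"
        using le[of s] le[of "cnj s"] that by simp
      finally show ?thesis .
    qed
    then show "\<forall>\<^sub>F s in ?A. norm (cscale (1 / 2) (F s + cconj (F (cnj s)))) \<le> norm (U s) + norm (U (cnj s))"
      by (simp add: eventually_inf_principal)
    show "((\<lambda>s. norm (U s) + norm (U (cnj s))) \<longlongrightarrow> 0) ?A"
      using tendsto_add[OF tendsto_norm[OF limU] tendsto_norm[OF limU']] by simp
  qed
  moreover have "vector_holomorphic_on (\<lambda>s. cscale (1 / 2) (F s + cconj (F (cnj s)))) ?S"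
    by (intro vector_holomorphic_on_cscale vector_holomorphic_on_add holF
        vector_holomorphic_on_reflect[OF holF S] holomorphic_on_const)
  ultimately show ?thesis unfolding strictly_proper_def by blast
qed

lemma continuous_imp_measurable_on_Ici:
  fixes f :: "real \<Rightarrow> 'a::real_normed_vector"
  assumes "continuous_on UNIV f"
  shows "f measurable_on {0..}"
proof -
  have "(\<lambda>x. if x \<in> {0..} then f x else 0) measurable_on UNIV"
    by (rule measurable_on_restrict[OF continuous_imp_measurable_on[OF assms]]) simp
  then show ?thesis by (simp only: measurable_on_UNIV)
qed

section \<open>Left invertibility\<close>

context linear_delay_system
begin

text \<open>That the transform of \<open>w\<close> lies in the domain and solves the transformed
  equation is part of the conclusion: only the values of \<open>w\<close> are known to be in the
  domain.\<close>

lemma time_solution_laplace: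
  assumes reg: "regular s" and h: "delay \<Sigma> > 0" and sol: "time_solution \<Sigma> u w"
    and W: "(laplace_integrand s w has_integral W) {0..}"
    and We: "(laplace_integrand s (\<lambda>t. blockE \<Sigma> (w t)) has_integral We) {0..}"
    and W0: "(laplace_integrand s (\<lambda>t. blockA0 \<Sigma> (w t)) has_integral W0) {0..}"
    and W1: "(laplace_integrand s (\<lambda>t. blockA1 \<Sigma> (w t)) has_integral W1) {0..}"
    and U: "(laplace_integrand s u has_integral U) {0..}"
  shows "W = resolvent s (cext (blockB \<Sigma>) U)"
proof -
  define q where "q = delay_factor \<Sigma> s"
  note sol' = sol[unfolded time_solution_def]
  have w0: "w 0 = 0" "\<And>t. t \<in> {- delay \<Sigma>..<0} \<Longrightarrow> w t = 0"
    and dom: "\<And>t. t \<ge> 0 \<Longrightarrow> w t \<in> state_dom \<Sigma>"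
    using sol' by simp_all
  from sol'[THEN conjunct2, THEN conjunct2, THEN conjunct2, THEN conjunct1] obtain w'
    where w': "\<forall>t\<ge>0. snd (w' t) \<in> domE \<Sigma> \<and> (w has_vector_derivative w' t) (at t within {0..}) \<and>
        ((\<lambda>\<tau>. blockE \<Sigma> (w \<tau>)) has_vector_derivative blockE \<Sigma> (w' t)) (at t within {0..}) \<and>
        blockE \<Sigma> (w' t) = blockA0 \<Sigma> (w t) + blockA1 \<Sigma> (w (t - delay \<Sigma>)) + blockB \<Sigma> (u t)"
    by (elim exE)
  have deriv: "((\<lambda>\<tau>. blockE \<Sigma> (w \<tau>)) has_vector_derivative blockE \<Sigma> (w' t)) (at t within {0..})"
    and eq: "blockE \<Sigma> (w' t) = blockA0 \<Sigma> (w t) + blockA1 \<Sigma> (w (t - delay \<Sigma>)) + blockB \<Sigma> (u t)"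
    if "t \<ge> 0" for t
    using w'[rule_format, OF that] by - (elim conjE, assumption)+
  have zero: "blockE \<Sigma> 0 = 0" "blockA0 \<Sigma> 0 = 0" "blockA1 \<Sigma> 0 = 0" "blockB \<Sigma> 0 = 0"
    using linear_operator_onD(6)[OF linear_blockE] linear_operator_onD(6)[OF linear_blockA0]
      linear_operator_onD(6)[OF linear_blockA1] linear_operator_onD(6)[OF linear_blockB] by auto
  have W1': "(laplace_integrand s (\<lambda>t. blockA1 \<Sigma> (w (t - delay \<Sigma>))) has_integral cscale q W1) {0..}"
    unfolding laplace_integrand_def q_def delay_factor_def
    by (rule laplace_delay[OF less_imp_le[OF h] W1[unfolded laplace_integrand_def]]) (simp add: w0 zero)
  have blBc: "bounded_linear (cext (blockB \<Sigma>))"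
    unfolding cext_def
    by (intro bounded_linear_Pair bounded_linear_compose[OF bounded_linear_blockB]
        bounded_linear_fst bounded_linear_snd)
  have UB: "(laplace_integrand s (\<lambda>t. blockB \<Sigma> (u t)) has_integral cext (blockB \<Sigma>) U) {0..}"
    using has_integral_linear[OF U blBc]
    by (simp add: o_def cext_laplace_integrand[OF linear_blockB])
  \<comment> \<open>A transform of E w' is not among the data of a solution. It exists because the
    differential equation writes E w' as a sum of terms that have transforms.\<close>
  have "((\<lambda>t. laplace_integrand s (\<lambda>t. blockA0 \<Sigma> (w t)) t + laplace_integrand s (\<lambda>t. blockA1 \<Sigma> (w (t - delay \<Sigma>))) t + laplace_integrand s (\<lambda>t. blockB \<Sigma> (u t)) t)
      has_integral (W0 + cscale q W1 + cext (blockB \<Sigma>) U)) {0..}"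
    by (intro has_integral_add W0 W1' UB)
  then have "(laplace_integrand s (\<lambda>t. blockE \<Sigma> (w' t)) has_integral (W0 + cscale q W1 + cext (blockB \<Sigma>) U)) {0..}"
    by (rule has_integral_eq[rotated]) (simp add: laplace_integrand_def eq flip: cscale_add_right)
  then have sWe: "W0 + cscale q W1 + cext (blockB \<Sigma>) U = cscale s We"
    unfolding laplace_integrand_def
    by (intro laplace_derivative[OF deriv _ We[unfolded laplace_integrand_def]]) (simp_all add: w0 zero)
  have dom0: "(w t, 0) \<in> state_dom \<Sigma> \<times> state_dom \<Sigma>" if "t \<ge> 0" for t
    using dom[OF that] subspace_0[OF subspace_state_dom] by simp
  have Ldom: "laplace_integrand s w t \<in> state_dom \<Sigma> \<times> state_dom \<Sigma>" if "t \<ge> 0" for t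
    unfolding laplace_integrand_def by (rule subspace_cscale[OF subspace_state_dom dom0[OF that]])
  have P: "pencil \<Sigma> s q (laplace_integrand s w t) = cscale s (laplace_integrand s (\<lambda>t. blockE \<Sigma> (w t)) t) - laplace_integrand s (\<lambda>t. blockA0 \<Sigma> (w t)) t
      - cscale q (laplace_integrand s (\<lambda>t. blockA1 \<Sigma> (w t)) t)" if "t \<ge> 0" for t
    unfolding pencil_def cext_laplace_integrand[where f = w, OF linear_blockE dom[OF that]]
      cext_laplace_integrand[where f = w, OF linear_blockA0 dom[OF that]]
      cext_laplace_integrand[where f = w, OF linear_blockA1 dom[OF that]] ..
  have "((\<lambda>t. cscale s (laplace_integrand s (\<lambda>t. blockE \<Sigma> (w t)) t) - laplace_integrand s (\<lambda>t. blockA0 \<Sigma> (w t)) t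
      - cscale q (laplace_integrand s (\<lambda>t. blockA1 \<Sigma> (w t)) t)) has_integral (cscale s We - W0 - cscale q W1)) {0..}"
    using has_integral_linear[OF We bounded_linear_cscale_right[of s]]
      has_integral_linear[OF W1 bounded_linear_cscale_right[of q]]
    by (intro has_integral_diff W0) (simp_all add: o_def)
  moreover have "cscale s We - W0 - cscale q W1 = cext (blockB \<Sigma>) U"
    using sWe by (simp add: algebra_simps)
  ultimately have "((\<lambda>t. cscale s (laplace_integrand s (\<lambda>t. blockE \<Sigma> (w t)) t) -
      laplace_integrand s (\<lambda>t. blockA0 \<Sigma> (w t)) t -
      cscale q (laplace_integrand s (\<lambda>t. blockA1 \<Sigma> (w t)) t)) has_integral cext (blockB \<Sigma>) U) {0..}"
    by (simp only:)
  then have "((\<lambda>t. pencil \<Sigma> s q (laplace_integrand s w t)) has_integral cext (blockB \<Sigma>) U) {0..}"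
    by (rule has_integral_eq[rotated]) (simp add: P)
  \<comment> \<open>Under the integral sign the inverse cancels the pencil pointwise, since each
    value of the integrand is in the domain.\<close>
  from has_integral_linear[OF this bounded_linear_resolvent[OF reg]]
  have "((\<lambda>t. resolvent s (pencil \<Sigma> s q (laplace_integrand s w t))) has_integral resolvent s (cext (blockB \<Sigma>) U)) {0..}"
    by (simp add: o_def)
  then have "(laplace_integrand s w has_integral resolvent s (cext (blockB \<Sigma>) U)) {0..}"
    by (rule has_integral_eq[rotated]) (auto simp: q_def intro!: resolvent_eqI[OF reg] Ldom simp del: mem_Sigma_iff)
  then show ?thesis using W by (rule has_integral_unique[rotated])
qed

text \<open>Brings both kinds of output, from a time-domain state or from a transformed one, to a
  single relation between transforms.\<close>

lemma output_laplace:
  assumes h: "delay \<Sigma> > 0" and reg: "\<forall>\<^sub>F s in right_half_planes. regular s"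
    and out: "is_output \<Sigma> u y" and U: "has_laplace u U"
  obtains Y where "has_laplace y Y" "\<forall>\<^sub>F s in right_half_planes. Y s = transfer s (U s)"
proof -
  from out consider (time) w where "time_solution \<Sigma> u w" "\<forall>t\<ge>0. y t = blockC \<Sigma> (w t)"
    | (transformed) U' W Y where "has_laplace u U'" "has_laplace y Y" "transformed_solution \<Sigma> U' W Y"
    unfolding is_output_def by blast
  then show ?thesis
  proof cases
    case time
    then obtain W We W0 W1 where int: "has_laplace w W" "has_laplace (\<lambda>t. blockE \<Sigma> (w t)) We"
      "has_laplace (\<lambda>t. blockA0 \<Sigma> (w t)) W0" "has_laplace (\<lambda>t. blockA1 \<Sigma> (w t)) W1"
      unfolding time_solution_def by blast
    have blCc: "bounded_linear (cext (blockC \<Sigma>))"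
      unfolding cext_def
      by (intro bounded_linear_Pair bounded_linear_compose[OF bounded_linear_blockC]
          bounded_linear_fst bounded_linear_snd)
    have "has_laplace y (\<lambda>s. cext (blockC \<Sigma>) (W s))"
      using int(1) unfolding has_laplace_iff
    proof eventually_elim
      case (elim s)
      from has_integral_linear[OF elim blCc] show ?case
        by (rule has_integral_eq[rotated])
           (use time(2) in \<open>simp add: cext_laplace_integrand[OF linear_blockC], simp add: laplace_integrand_def\<close>)
    qed
    moreover have "\<forall>\<^sub>F s in right_half_planes. cext (blockC \<Sigma>) (W s) = transfer s (U s)"
      using reg int[unfolded has_laplace_iff] U[unfolded has_laplace_iff]
    proof eventually_elim
      case (elim s)
      then show ?case
        using time_solution_laplace[OF elim(1) h time(1) elim(2-6)] by (simp add: transfer_eq)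
    qed
    ultimately show ?thesis by (rule that)
  next
    case transformed
    have "\<forall>\<^sub>F s in right_half_planes. Y s = transfer s (U s)"
      using reg U[unfolded has_laplace_iff] transformed(1)[unfolded has_laplace_iff]
        transformed(3)[unfolded transformed_solution_def]
    proof eventually_elim
      case (elim s)
      \<comment> \<open>The transformed solution carries its own transform of \<open>u\<close>; two
        transforms of one signal agree wherever both integrals converge.\<close>
      have "U s = U' s" using elim(2,3) by (rule has_integral_unique)
      moreover have "resolvent s (cext (blockB \<Sigma>) (U' s)) = W s"
        using elim by (intro resolvent_eqI) auto
      ultimately show ?case using elim by (simp add: transfer_eq)
    qed
    with transformed(2) show ?thesis by (rule that)
  qed
qed

lemma left_invertibleI:
  assumes h: "delay \<Sigma> > 0" and reg: "\<forall>\<^sub>F s in right_half_planes. regular s"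
    and inj: "\<And>U. U \<in> strictly_proper \<Longrightarrow> \<forall>\<^sub>F s in right_half_planes. transfer s (U s) = 0 \<Longrightarrow>
      \<forall>\<^sub>F s in right_half_planes. U s = 0"
  shows "left_invertible \<Sigma>"
  unfolding left_invertible_def
proof (intro allI impI)
  fix u y assume u: "admissible_input u" and out: "is_output \<Sigma> u y" and y: "null_signal y"
  obtain U where U: "U \<in> strictly_proper" "has_laplace u U" and meas: "u measurable_on {0..}"
    using u by (auto simp: admissible_input_def)
  obtain Y where Y: "has_laplace y Y" "\<forall>\<^sub>F s in right_half_planes. Y s = transfer s (U s)"
    using output_laplace[OF h reg out U(2)] .
  have "\<forall>\<^sub>F s in right_half_planes. transfer s (U s) = 0"
    using Y(2) null_signal_imp_laplace_zero[OF y Y(1)] by eventually_elim simp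
  then show "null_signal u"
    by (intro null_signal_of_laplace_zero[OF meas U(2)] inj[OF U(1)])
qed

lemma left_invertible_imp_real_part_zero:
  assumes reg: "\<forall>\<^sub>F s in right_half_planes. regular s" and inv: "left_invertible \<Sigma>"
    and U: "U \<in> strictly_proper" and TU: "\<forall>\<^sub>F s in right_half_planes. transfer s (U s) = 0"
  shows "\<forall>\<^sub>F s in right_half_planes. U s + cconj (U (cnj s)) = 0"
proof -
  obtain a where hol: "vector_holomorphic_on U {s. Re s > a}"
      and lim: "(U \<longlongrightarrow> 0) (inf at_infinity (principal {s. Re s > a}))"
    using U by (auto simp: strictly_proper_def)
  obtain M where M: "\<And>s. Re s \<ge> a + 1 \<Longrightarrow> norm (U s) \<le> M"
    using strictly_proper_bounded[OF hol lim] by blast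
  \<comment> \<open>The pole lies on the boundary line Re s = a, so \<open>g\<close> is holomorphic
    without zeros on the open half-plane, and its modulus is at most 1 on Re s >= a + 1.\<close>
  define g where "g = (\<lambda>s :: complex. inverse ((s - of_real a) ^ 4))"
  define F where "F = (\<lambda>s. cscale (g s) (U s))"
  have holF: "vector_holomorphic_on F {s. Re s > a}"
    unfolding F_def g_def
    by (intro vector_holomorphic_on_cscale hol holomorphic_intros) auto
  have normF: "norm (F s) = norm (U s) / cmod (s - of_real a) ^ 4" for s
    by (simp add: F_def g_def norm_cscale norm_inverse norm_power divide_inverse mult.commute)
  have "norm (F s) \<le> M / cmod (s - of_real a) ^ 4" if "Re s \<ge> a + 1" for s
    unfolding normF by (intro divide_right_mono M that) simp
  with holF obtain k where contk: "continuous_on UNIV k"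
    and k: "\<And>s. Re s > a + 1 \<Longrightarrow> ((\<lambda>t. cscale (exp (- s * of_real t)) (k t)) has_integral F s) {0..}"
    using inverse_laplace_transform by blast
  define u where "u = (\<lambda>t. fst (k t))"
  define V where "V = (\<lambda>s. cscale (1 / 2) (F s + cconj (F (cnj s))))"
  have lapu: "has_laplace u V"
    unfolding has_laplace_def eventually_right_half_planes
  proof (intro exI allI impI)
    fix s assume s: "Re s > a + 1"
    \<comment> \<open>The transform of the conjugate of \<open>k\<close> is
      \<open>cconj (F (cnj s))\<close>. Averaging it with \<open>F\<close> gives the transform of
      the real signal \<open>u\<close>.\<close>
    have "((\<lambda>t. cconj (cscale (exp (- cnj s * of_real t)) (k t))) has_integral cconj (F (cnj s))) {0..}"
      using has_integral_linear[OF k[of "cnj s"] bounded_linear_cconj] s by (simp add: o_def)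
    from has_integral_linear[OF has_integral_add[OF k[OF s] this] bounded_linear_cscale_right[of "1 / 2"]]
    show "((\<lambda>t. cscale (exp (- s * of_real t)) (u t, 0)) has_integral V s) {0..}"
      unfolding V_def
    proof (rule has_integral_eq[rotated])
      fix t :: real
      have c: "cscale (1 / 2) (k t + cconj (k t)) = (u t, 0)"
        by (simp add: cscale_def cconj_def u_def prod_eq_iff scaleR_2[symmetric])
      have e: "cnj (exp (- cnj s * of_real t)) = exp (- s * of_real t)"
        by (simp add: exp_cnj)
      show "(cscale (1 / 2) \<circ> (\<lambda>t. cscale (exp (- s * of_real t)) (k t) +
          cconj (cscale (exp (- cnj s * of_real t)) (k t)))) t = cscale (exp (- s * of_real t)) (u t, 0)"
        unfolding o_def cconj_cscale e cscale_add_right[symmetric] c[symmetric] cscale_cscale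
        by (simp only: mult.commute)
    qed
  qed
  have V: "V \<in> strictly_proper"
    unfolding V_def
  proof (rule strictly_proper_real_part[OF holF lim])
    fix s assume s: "Re s > a + 1"
    have "cmod (s - of_real a) \<ge> 1"
      using complex_Re_le_cmod[of "s - of_real a"] s by simp
    then have "1 \<le> cmod (s - of_real a) ^ 4" by (rule one_le_power)
    then show "norm (F s) \<le> norm (U s)"
      unfolding normF by (simp add: divide_le_eq mult_le_cancel_left1)
  qed simp
  have "continuous_on UNIV u" unfolding u_def by (intro continuous_intros contk)
  then have adm: "admissible_input u"
    unfolding admissible_input_def using V lapu continuous_imp_measurable_on_Ici by blast
  have TV: "\<forall>\<^sub>F s in right_half_planes. transfer s (V s) = 0"
    using reg eventually_right_half_planes_cnj[OF reg] TU eventually_right_half_planes_cnj[OF TU]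
  proof eventually_elim
    case (elim s)
    have "transfer s (cconj (F (cnj s))) = cconj (transfer (cnj s) (F (cnj s)))"
      using transfer_cconj[of "cnj s"] elim(1,2) by simp
    then show ?case
      using elim by (simp add: V_def F_def transfer_cscale transfer_add)
  qed
  \<comment> \<open>The state is defined by applying the inverse pencil at each s, and its output is
    the zero function of time.\<close>
  have "transformed_solution \<Sigma> V (\<lambda>s. resolvent s (cext (blockB \<Sigma>) (V s))) (\<lambda>_. 0)"
    unfolding transformed_solution_def using reg TV
    by eventually_elim (simp add: resolvent_mem pencil_resolvent transfer_eq del: mem_Sigma_iff)
  moreover have "has_laplace (\<lambda>_. 0 :: 'y \<times> 'y) (\<lambda>_. 0)"
    by (simp add: has_laplace_def zero_prod_def[symmetric])
  ultimately have "is_output \<Sigma> u (\<lambda>_. 0)"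
    unfolding is_output_def using lapu by blast
  then have "null_signal u"
    using inv adm unfolding left_invertible_def by (auto simp: null_signal_def)
  then have V0: "\<forall>\<^sub>F s in right_half_planes. V s = 0"
    using lapu by (rule null_signal_imp_laplace_zero)
  have "\<forall>\<^sub>F s in right_half_planes. Re s > a"
    unfolding eventually_right_half_planes by blast
  with V0 show ?thesis
  proof eventually_elim
    case (elim s)
    \<comment> \<open>As \<open>a\<close> is real, the conjugate of \<open>g (cnj s)\<close> is
      \<open>g s\<close>; the factor can be pulled out of the sum and, being nonzero,
      cancelled.\<close>
    have "V s = cscale (1 / 2 * g s) (U s + cconj (U (cnj s)))"
      by (simp add: V_def F_def cconj_cscale g_def cscale_add_right cscale_cscale)
    then have "cmod (1 / 2 * g s) * norm (U s + cconj (U (cnj s))) = 0"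
      using elim(1) by (simp only: norm_cscale[symmetric] norm_zero)
    moreover have "g s \<noteq> 0" using elim(2) by (auto simp: g_def)
    ultimately show ?case by simp
  qed
qed

lemma left_invertible_imp_transfer_injective:
  assumes reg: "\<forall>\<^sub>F s in right_half_planes. regular s" and inv: "left_invertible \<Sigma>"
    and U: "U \<in> strictly_proper" and TU: "\<forall>\<^sub>F s in right_half_planes. transfer s (U s) = 0"
  shows "\<forall>\<^sub>F s in right_half_planes. U s = 0"
proof -
  have "\<forall>\<^sub>F s in right_half_planes. transfer s (cscale \<i> (U s)) = 0"
    using reg TU by eventually_elim (simp add: transfer_cscale)
  from left_invertible_imp_real_part_zero[OF reg inv strictly_proper_cscale[OF U] this]
    left_invertible_imp_real_part_zero[OF reg inv U TU]
  show ?thesis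
  proof eventually_elim
    case (elim s)
    \<comment> \<open>The conjugate of \<open>\<i>\<close> is its negative, so the result for i U
      kills the difference of \<open>U s\<close> and its reflection. The result for \<open>U\<close>
      kills their sum.\<close>
    have "cscale \<i> (U s) + cconj (cscale \<i> (U (cnj s))) = cscale \<i> (U s - cconj (U (cnj s)))"
      by (simp add: cscale_def cconj_def prod_eq_iff)
    with elim(1) have "norm (U s - cconj (U (cnj s))) = 0"
      using norm_cscale[of \<i> "U s - cconj (U (cnj s))"] by simp
    then have "U s + U s = 0" using elim(2) by simp
    then show ?case by (simp add: scaleR_2[symmetric])
  qed
qed

end

theorem lemma2p3:
  fixes \<Sigma> :: "('u::{real_inner, banach}, 'h::{real_inner, banach}, 'y::{real_inner, banach})
    delay_system"
  assumes "delay \<Sigma> > 0" and "damping \<Sigma> \<ge> 0"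
    and "linear_operator_on (domE \<Sigma>) (opE \<Sigma>)"
    and "linear_operator_on (domA0 \<Sigma>) (opA0 \<Sigma>)"
    and "linear_operator_on (domA1 \<Sigma>) (opA1 \<Sigma>)"
    and "bounded_linear (opB \<Sigma>)" and "bounded_linear (opC \<Sigma>)"
    and "solvable \<Sigma>"
  shows "left_invertible \<Sigma> \<longleftrightarrow>
    (\<forall>U\<in>strictly_proper.
       (\<forall>\<^sub>F s in right_half_planes. transfer_function \<Sigma> s (exp (- s * of_real (delay \<Sigma>))) (U s) = 0) \<longrightarrow>
       (\<forall>\<^sub>F s in right_half_planes. U s = 0))"
proof -
  interpret linear_delay_system \<Sigma>
    by (rule linear_delay_system.intro) (fact assms)+
  have reg: "\<forall>\<^sub>F s in right_half_planes. regular s"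
    using \<open>solvable \<Sigma>\<close> by (simp add: solvable_def regular_def)
  have T: "transfer_function \<Sigma> s (exp (- s * of_real (delay \<Sigma>))) x = transfer s x" for s x
    by (simp add: transfer_def delay_factor_def)
  show ?thesis
    unfolding T
    using left_invertibleI[OF \<open>delay \<Sigma> > 0\<close> reg] left_invertible_imp_transfer_injective[OF reg]
    by blast
qed

end
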